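(* For $|\arg x|<\frac14\pi$ and $w\in\mathbb{C}$, we have $$K_{0,w}(x)=\int_{0}^{\infty}\exp\left(-\frac{w^2x^2}{2(x^2+u^2)}\right)\cos\left(\frac{w^2xu}{2(x^2+u^2)}\right)\frac{\cos u\,du}{\sqrt{x^2+u^2}}.$$
   Context: The generalized modified Bessel function is defined, for $z,w\in\mathbb{C}$, by $$K_{z,w}(x):=\frac{1}{2\pi i}\int_{c-i\infty}^{c+i\infty}\Gamma\left(\tfrac{s-z}{2}\right)\Gamma\left(\tfrac{s+z}{2}\right)\,{}_1F_1\left(\tfrac{s-z}{2};\tfrac12;-\tfrac{w^2}{4}\right){}_1F_1\left(\tfrac{s+z}{2};\tfrac12;-\tfrac{w^2}{4}\right)2^{s-2}x^{-s}\,ds,$$ where $c=\mathrm{Re}(s)>|\mathrm{Re}(z)|$ and powers of $x$ are principal; here it is used with $z=0$. ${}_1F_1(a;c;u)=\sum_{n\ge0}\frac{(a)_n u^n}{(c)_n n!}$ with $(a)_n=a(a+1)\cdots(a+n-1)$. The integral in the claim is a (conditionally convergent) improper integral, and the square root is principal. *)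

theory Defs
  imports "HOL-Analysis.Analysis"
begin

definition hyp1F1 :: "complex \<Rightarrow> complex \<Rightarrow> complex \<Rightarrow> complex" where
  "hyp1F1 a c u = (\<Sum>n. pochhammer a n * u ^ n / (pochhammer c n * fact n))"

definition gen_bessel_integrand :: "complex \<Rightarrow> complex \<Rightarrow> complex \<Rightarrow> complex \<Rightarrow> complex" where
  "gen_bessel_integrand z w x s =
     Gamma ((s - z) / 2) * Gamma ((s + z) / 2)
     * hyp1F1 ((s - z) / 2) (1 / 2) (- (w\<^sup>2 / 4)) * hyp1F1 ((s + z) / 2) (1 / 2) (- (w\<^sup>2 / 4))
     * 2 powr (s - 2) * x powr (- s)"

text \<open>
  The integral over the vertical line from \<open>c - \<i>\<infinity>\<close> to \<open>c + \<i>\<infinity>\<close> is parametrised by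
  \<open>s = c + \<i> t\<close>, \<open>ds = \<i> dt\<close>. The abscissa \<open>c\<close> is an explicit argument, to be taken
  with \<open>c > \<bar>Re z\<bar>\<close>. The Lebesgue integral is 0 when the integrand is not integrable,
  so statements about this function should also assert integrability.
\<close>
definition gen_bessel_K :: "real \<Rightarrow> complex \<Rightarrow> complex \<Rightarrow> complex \<Rightarrow> complex" where
  "gen_bessel_K c z w x =
     1 / (2 * of_real pi * \<i>) * (LBINT t. gen_bessel_integrand z w x (Complex c t) * \<i>)"

end

theory Submission
  imports Defs "HOL-Probability.Probability" "HOL-Real_Asymp.Real_Asymp"
begin

text \<open>
Both sides equal the absolutely convergent integral
\<open>J = \<integral> exp (- x\<^sup>2 r\<^sup>2 - 1 / (4 r\<^sup>2)) cos (w x r) cos (w / (2 r)) dr / r\<close> over \<open>r > 0\<close>, written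
below with \<open>r = exp v\<close> as an integral over the real line.

For the left-hand side, integrating the cosine series term by term against a Gaussian shows that
\<open>Gamma (s / 2) * hyp1F1 (s / 2) (1 / 2) (- w\<^sup>2 / 4) * x powr (- s) / 2\<close> is the Mellin transform of
\<open>exp (- x\<^sup>2 r\<^sup>2) cos (w x r)\<close>, for complex \<open>x\<close> with \<open>\<bar>Arg x\<bar> < pi / 4\<close>
(\<open>has_bochner_integral_gauss_cos_rotated\<close>). The integrand defining \<open>gen_bessel_K\<close> is the product of
two such transforms, at \<open>x\<close> and at \<open>1 / 2\<close>. Moving \<open>x\<close> a little inside the sector shows that they decay
exponentially along vertical lines (\<open>gauss_transform_decay\<close>); this gives the integrability, and with
Fourier inversion, in the form \<open>fourier_parseval\<close>, the value \<open>J\<close> (\<open>gen_bessel_K_eq\<close>).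

For the right-hand side, the kernel is the integral over \<open>r\<close> of
\<open>exp (- (x\<^sup>2 + u\<^sup>2) r\<^sup>2) cos (w x r) cosh (w u r)\<close>, up to the constant \<open>2 exp (- w\<^sup>2 / 4) / sqrt pi\<close>
(\<open>has_bochner_integral_kernel\<close>). Over \<open>u\<close> in a bounded interval \<open>{0..R}\<close> the integrations may be exchanged
(\<open>truncated_integral_eq\<close>), which leaves the inner integral of \<open>cos u exp (- u\<^sup>2 r\<^sup>2) cosh (w u r)\<close>
over \<open>{0..R}\<close>. As \<open>R\<close> grows, that integral tends to a multiple of
\<open>exp (- 1 / (4 r\<^sup>2)) cos (w / (2 r)) / r\<close>, the factor missing in \<open>J\<close>. The improper integral over \<open>u\<close> converges
only conditionally, so the limit needs a bound on the truncated integrals that is uniform in \<open>R\<close> and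
\<open>r\<close>; integration by parts provides it (\<open>trunc_cos_integral_bounded\<close>).
\<close>

section \<open>Mellin transforms of Gaussians times cosines\<close>

text \<open>
With \<open>r = exp v\<close> this is \<open>exp (- A r\<^sup>2) cos (k r) r powr s\<close>, and \<open>dv = dr / r\<close>: integrals of
\<open>gauss_cos\<close> over the real line are Mellin transforms over the half-line \<open>r > 0\<close>. The logarithmic
variable makes the powers of \<open>r\<close> exponentials and turns the Mellin transform along a vertical line
into a Fourier transform.
\<close>

definition gauss_cos :: "complex \<Rightarrow> complex \<Rightarrow> complex \<Rightarrow> real \<Rightarrow> complex" where
  "gauss_cos A k s v =
     exp (- (A * of_real (exp (2 * v)))) * cos (k * of_real (exp v)) * exp (s * of_real v)"

lemma continuous_on_gauss_cos: "continuous_on S (gauss_cos A k s)"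
  unfolding gauss_cos_def by (intro continuous_intros)

lemma gauss_cos_measurable [measurable]: "gauss_cos A k s \<in> borel_measurable borel"
  by (intro borel_measurable_continuous_onI continuous_on_gauss_cos)

lemma has_bochner_integral_exp_double_exp_real:
  assumes \<rho>: "\<rho> > 0" and s: "Re s > 0"
  shows "has_bochner_integral lborel (gauss_cos (of_real \<rho>) 0 s)
           (Gamma (s / 2) * of_real \<rho> powr (- (s / 2)) / 2)"
proof -
  define f :: "real \<Rightarrow> complex" where "f t = of_real t powr (s / 2 - 1) / of_real (exp t)" for t
  define g where "g v = \<rho> * exp (2 * v)" for v :: real
  have f: "f absolutely_integrable_on {0<..} \<and> integral {0<..} f = Gamma (s / 2)"
    unfolding f_def using absolutely_integrable_Gamma_integral'[of "s / 2"]
      Gamma_integral_complex'[of "s / 2"] s by (auto simp: integral_unique)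
  have surj: "range g = {0<..}"
  proof (intro equalityI subsetI)
    fix y :: real assume "y \<in> {0<..}"
    then have "y = g (ln (y / \<rho>) / 2)" using \<rho> by (simp add: g_def)
    then show "y \<in> range g" by blast
  qed (use \<rho> in \<open>auto simp: g_def\<close>)
  have "inj g" using \<rho> by (auto simp: g_def inj_on_def)
  moreover have "(g has_field_derivative 2 * g v) (at v)" for v
    unfolding g_def by (auto intro!: derivative_eq_intros)
  ultimately have *: "(\<lambda>v. \<bar>2 * g v\<bar> *\<^sub>R f (g v)) absolutely_integrable_on UNIV \<and>
      integral UNIV (\<lambda>v. \<bar>2 * g v\<bar> *\<^sub>R f (g v)) = Gamma (s / 2)"
    using has_absolute_integral_change_of_variables_real[of UNIV g "\<lambda>v. 2 * g v" f "Gamma (s/2)"] f surj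
    by (simp del: UNIV_I)
  have eq: "\<bar>2 * g v\<bar> *\<^sub>R f (g v) = (2 * of_real \<rho> powr (s / 2)) * gauss_cos (of_real \<rho>) 0 s v" for v
  proof -
    have pos: "g v > 0" using \<rho> by (simp add: g_def)
    have "of_real (g v) * (of_real (g v) powr (s / 2 - 1)) = (of_real (g v) :: complex) powr (s / 2)"
      using pos by (simp add: powr_diff)
    also have "of_real (g v) powr (s / 2) = of_real \<rho> powr (s / 2) * exp (s * of_real v)"
    proof -
      have "Ln (of_real (g v)) = Ln (of_real \<rho>) + 2 * of_real v"
        using \<rho> pos by (simp add: Ln_of_real) (simp add: g_def ln_mult)
      then show ?thesis
        using \<rho> pos by (auto simp add: powr_def exp_add[symmetric] algebra_simps add_divide_distrib)
    qed
    finally show ?thesis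
      using pos \<rho> by (simp add: f_def gauss_cos_def scaleR_conv_of_real exp_minus exp_of_real field_simps)
         (simp add: g_def exp_of_real[symmetric] mult.commute)
  qed
  \<comment> \<open>The change of variables lives on the completed measure; the constant is divided out at the end.\<close>
  define C where "C = 2 * of_real \<rho> powr (s / 2)"
  have C0: "C \<noteq> 0" using \<rho> by (simp add: C_def)
  have i1: "integrable lborel (\<lambda>v. C * gauss_cos (of_real \<rho>) 0 s v)"
  proof -
    have "set_integrable lebesgue UNIV (\<lambda>v. C * gauss_cos (of_real \<rho>) 0 s v)"
      using * unfolding eq C_def by blast
    then show ?thesis
      by (simp add: set_integrable_def integrable_completion)
  qed
  have i2: "integrable lborel (gauss_cos (of_real \<rho>) 0 s)"
    using integrable_mult_right[OF i1, of "1 / C"] C0 by simp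
  have "((\<lambda>v. C * gauss_cos (of_real \<rho>) 0 s v) has_integral (\<integral>v. C * gauss_cos (of_real \<rho>) 0 s v \<partial>lborel)) UNIV"
    by (rule has_integral_integral_lborel[OF i1])
  then have "(\<integral>v. C * gauss_cos (of_real \<rho>) 0 s v \<partial>lborel) = Gamma (s / 2)"
    using * unfolding eq C_def by (metis integral_unique)
  then have "C * integral\<^sup>L lborel (gauss_cos (of_real \<rho>) 0 s) = Gamma (s / 2)"
    by simp
  then have "integral\<^sup>L lborel (gauss_cos (of_real \<rho>) 0 s) = Gamma (s / 2) * of_real \<rho> powr (- (s / 2)) / 2"
    using \<rho> by (simp add: C_def powr_minus field_simps)
  with i2 show ?thesis by (simp add: has_bochner_integral_iff)
qed

lemma norm_gauss_cos_0: "norm (gauss_cos A 0 s v) = Re (gauss_cos (of_real (Re A)) 0 (of_real (Re s)) v)"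
proof -
  have "gauss_cos (of_real (Re A)) 0 (of_real (Re s)) v
      = of_real (exp (- (Re A * exp (2 * v))) * exp (Re s * v))"
    unfolding gauss_cos_def by (simp flip: exp_of_real)
  moreover have "norm (gauss_cos A 0 s v) = exp (- (Re A * exp (2 * v))) * exp (Re s * v)"
    unfolding gauss_cos_def by (simp add: norm_mult)
  ultimately show ?thesis by simp
qed

text \<open>
Term by term, the weight \<open>exp (- A r\<^sup>2)\<close> sends \<open>r ^ (2 * n)\<close> to a shifted Gamma value, hence to a
Pochhammer symbol. The exchange with the sum is by absolute convergence, and there \<open>A\<close> and \<open>s\<close> become
their real parts; this is the origin of the summability hypothesis. The integral without a series is
a hypothesis because the lemma has two applications: for real \<open>A\<close> it gives the Gamma integral for
complex \<open>A\<close>, and for complex \<open>A\<close> it then gives Kummer's function.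
\<close>

lemma has_bochner_integral_exp_double_exp_series:
  fixes a :: "nat \<Rightarrow> complex"
  assumes A: "Re A > 0" and s: "Re s > 0"
    and base: "\<And>s. Re s > 0 \<Longrightarrow> has_bochner_integral lborel (gauss_cos A 0 s)
           (Gamma (s / 2) * A powr (- (s / 2)) / 2)"
    and summ: "summable (\<lambda>n. norm (a n) * pochhammer (Re s / 2) n / Re A ^ n)"
    and F: "\<And>v. (\<lambda>n. a n * of_real (exp (2 * v)) ^ n) sums F v"
    and absF: "\<And>v. summable (\<lambda>n. norm (a n * of_real (exp (2 * v)) ^ n))"
    and S: "(\<lambda>n. a n * pochhammer (s / 2) n / A ^ n) sums S"
  shows "has_bochner_integral lborel (\<lambda>v. gauss_cos A 0 s v * F v)
           (Gamma (s / 2) * A powr (- (s / 2)) / 2 * S)"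
proof -
  define f where "f n v = a n * gauss_cos A 0 (s + 2 * of_nat n) v" for n v
  have pos: "Re (s + 2 * of_nat n) > 0" for n using s by simp
  have b: "has_bochner_integral lborel (f n)
     (a n * (Gamma ((s + 2 * of_nat n) / 2) * A powr (- ((s + 2 * of_nat n) / 2)) / 2))" for n
    unfolding f_def by (intro has_bochner_integral_mult_right base pos)
  have f_eq: "f n v = gauss_cos A 0 s v * (a n * of_real (exp (2 * v)) ^ n)" for n v
    unfolding f_def gauss_cos_def
    by (simp add: exp_of_nat_mult[symmetric] exp_add[symmetric] algebra_simps flip: exp_of_real)
  have fs: "(\<lambda>n. f n v) sums (gauss_cos A 0 s v * F v)" for v
    unfolding f_eq by (intro sums_mult F)
  have nf: "(\<integral>v. norm (f n v) \<partial>lborel) =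
     Gamma (Re s / 2) * (Re A) powr (- (Re s / 2)) / 2 * (norm (a n) * pochhammer (Re s / 2) n / Re A ^ n)" for n
  proof -
    have "has_bochner_integral lborel (gauss_cos (of_real (Re A)) 0 (of_real (Re s + 2 * n)))
      (Gamma (of_real (Re s + 2 * n) / 2) * of_real (Re A) powr (- (of_real (Re s + 2 * n) / 2)) / 2)"
      by (intro has_bochner_integral_exp_double_exp_real A) (use s in simp)
    also have "(Gamma (of_real (Re s + 2 * n) / 2) * of_real (Re A) powr (- (of_real (Re s + 2 * n) / 2)) / 2)
      = complex_of_real (Gamma (Re s / 2 + n) * Re A powr (- (Re s / 2 + n)) / 2)"
      using A by (simp add: powr_of_real[symmetric] Gamma_complex_of_real[symmetric] add_divide_distrib)
    finally have h: "has_bochner_integral lborel (gauss_cos (of_real (Re A)) 0 (of_real (Re s + 2 * n)))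
      (complex_of_real (Gamma (Re s / 2 + n) * Re A powr (- (Re s / 2 + n)) / 2))" .
    have "has_bochner_integral lborel (\<lambda>v. norm (a n) * norm (gauss_cos A 0 (s + 2 * of_nat n) v))
        (norm (a n) * (Gamma (Re s / 2 + n) * Re A powr (- (Re s / 2 + n)) / 2))"
      using has_bochner_integral_bounded_linear[OF bounded_linear_Re h]
      by (intro has_bochner_integral_mult_right) (simp add: norm_gauss_cos_0)
    then have "(\<integral>v. norm (f n v) \<partial>lborel) = norm (a n) * (Gamma (Re s / 2 + n) * Re A powr (- (Re s / 2 + n)) / 2)"
      unfolding f_def norm_mult by (rule has_bochner_integral_integral_eq)
    moreover have "Gamma (Re s / 2 + n) = pochhammer (Re s / 2) n * Gamma (Re s / 2)"
      using s by (subst pochhammer_Gamma) (auto simp: Gamma_eq_zero_iff elim!: nonpos_Ints_cases)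
    moreover have "Re A powr (- (Re s / 2 + n)) = Re A powr (- (Re s / 2)) / Re A ^ n"
      using A by (simp add: powr_diff powr_realpow)
    ultimately show ?thesis by (simp add: mult_ac)
  qed
  have int: "integrable lborel (f n)" for n using b by (simp add: has_bochner_integral_iff)
  have ae: "AE v in lborel. summable (\<lambda>n. norm (f n v))"
    unfolding f_eq norm_mult[of "gauss_cos A 0 s _"] by (intro AE_I2 summable_mult absF)
  have su: "summable (\<lambda>n. \<integral>v. norm (f n v) \<partial>lborel)"
    unfolding nf by (intro summable_mult summ)
  have eqF: "(\<lambda>v. \<Sum>n. f n v) = (\<lambda>v. gauss_cos A 0 s v * F v)"
    using fs by (simp add: sums_iff)
  have i: "integrable lborel (\<lambda>v. gauss_cos A 0 s v * F v)"
    using integrable_suminf[OF int ae su] by (simp add: eqF)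
  have "(\<lambda>n. integral\<^sup>L lborel (f n)) sums (\<integral>v. gauss_cos A 0 s v * F v \<partial>lborel)"
    using sums_integral[OF int ae su] by (simp add: eqF)
  moreover have "integral\<^sup>L lborel (f n) = Gamma (s / 2) * A powr (- (s / 2)) / 2 * (a n * pochhammer (s / 2) n / A ^ n)" for n
  proof -
    have A0: "A \<noteq> 0" using A by auto
    have "s / 2 \<notin> \<int>\<^sub>\<le>\<^sub>0" using s by (auto elim!: nonpos_Ints_cases simp: complex_eq_iff)
    then have "Gamma ((s + 2 * of_nat n) / 2) = pochhammer (s / 2) n * Gamma (s / 2)"
      by (subst pochhammer_Gamma) (auto simp: Gamma_eq_zero_iff add_divide_distrib)
    moreover have "A powr (- ((s + 2 * of_nat n) / 2)) = A powr (- (s / 2)) / A ^ n"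
      using A0 by (simp add: powr_diff powr_nat' add_divide_distrib)
    ultimately show ?thesis
      using has_bochner_integral_integral_eq[OF b[of n]] by (simp add: mult_ac)
  qed
  then have "(\<lambda>n. integral\<^sup>L lborel (f n)) sums (Gamma (s / 2) * A powr (- (s / 2)) / 2 * S)"
    using sums_mult[OF S, of "Gamma (s / 2) * A powr (- (s / 2)) / 2"] by (simp only:)
  ultimately have "(\<integral>v. gauss_cos A 0 s v * F v \<partial>lborel) = Gamma (s / 2) * A powr (- (s / 2)) / 2 * S"
    by (rule sums_unique2)
  with i show ?thesis by (simp add: has_bochner_integral_iff)
qed

lemma norm_of_real_diff_less:
  assumes "Re A > 0"
  obtains R where "R > 0" "norm (of_real R - A) < R"
proof -
  define R where "R = (norm A)\<^sup>2 / Re A"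
  have "A \<noteq> 0" using assms by auto
  then have R: "R > 0" using assms by (simp add: R_def)
  have "(norm (of_real R - A))\<^sup>2 = R\<^sup>2 - 2 * R * Re A + (norm A)\<^sup>2"
    unfolding cmod_power2 by (simp add: power2_eq_square algebra_simps)
  also have "\<dots> = R\<^sup>2 - R * Re A" using assms by (simp add: R_def)
  also have "\<dots> < R\<^sup>2" using R assms by simp
  finally have "norm (of_real R - A) < R" using R by (simp add: power2_less_imp_less)
  with R that show ?thesis by blast
qed

text \<open>
The Gamma integral with a complex scale: instead of rotating a contour, write
\<open>exp (- A r\<^sup>2) = exp (- R r\<^sup>2) exp ((R - A) r\<^sup>2)\<close> and expand the second factor. If
\<open>norm (R - A) < R\<close>, which is true of large \<open>R\<close> because \<open>Re A > 0\<close>, the resulting binomial series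
converges to \<open>(A / R) powr (- s / 2)\<close>.
\<close>

lemma has_bochner_integral_exp_double_exp:
  assumes A: "Re A > 0" and s: "Re s > 0"
  shows "has_bochner_integral lborel (gauss_cos A 0 s) (Gamma (s / 2) * A powr (- (s / 2)) / 2)"
proof -
  obtain R where R: "R > 0" and lt: "norm (of_real R - A) < R"
    using norm_of_real_diff_less[OF A] .
  define q where "q = (of_real R - A) / of_real R"
  have q: "norm q < 1" using R lt by (simp add: q_def norm_divide)
  define a :: "nat \<Rightarrow> complex" where "a n = (of_real R - A) ^ n / fact n" for n
  have aR: "a n / of_real R ^ n = q ^ n / fact n" for n
    by (simp add: a_def q_def power_divide)
  have "has_bochner_integral lborel (\<lambda>v. gauss_cos (of_real R) 0 s v * exp ((of_real R - A) * of_real (exp (2 * v))))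
      (Gamma (s / 2) * of_real R powr (- (s / 2)) / 2 * (1 - q) powr (- (s / 2)))"
  proof (rule has_bochner_integral_exp_double_exp_series)
    show "Re (of_real R) > 0" "Re s > 0" using R s by simp_all
    show "has_bochner_integral lborel (gauss_cos (of_real R) 0 s)
           (Gamma (s / 2) * of_real R powr (- (s / 2)) / 2)" if "Re s > 0" for s
      using that R by (rule has_bochner_integral_exp_double_exp_real[rotated])
    show "(\<lambda>n. a n * of_real (exp (2 * v)) ^ n) sums exp ((of_real R - A) * of_real (exp (2 * v)))" for v
      using exp_converges[of "(of_real R - A) * of_real (exp (2 * v))"]
      by (simp add: a_def power_mult_distrib scaleR_conv_of_real divide_inverse mult_ac)
    show "summable (\<lambda>n. norm (a n * of_real (exp (2 * v)) ^ n))" for v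
      using summable_norm_exp[of "(of_real R - A) * of_real (exp (2 * v))"]
      by (simp add: a_def power_mult_distrib scaleR_conv_of_real divide_inverse mult_ac)
    have "(\<lambda>n. ((- (s / 2)) gchoose n) * (- q) ^ n) sums (1 + (- q)) powr (- (s / 2))"
      using q by (intro gen_binomial_complex) simp
    moreover have "((- (s / 2)) gchoose n) * (- q) ^ n = a n * pochhammer (s / 2) n / of_real R ^ n" for n
    proof -
      have "((- (s / 2)) gchoose n) * (- q) ^ n = pochhammer (s / 2) n * ((- 1) ^ n * (- q) ^ n) / fact n"
        by (simp add: gbinomial_pochhammer)
      also have "(- 1) ^ n * (- q) ^ n = q ^ n"
        by (simp flip: power_mult_distrib)
      also have "pochhammer (s / 2) n * q ^ n / fact n = pochhammer (s / 2) n * (a n / of_real R ^ n)"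
        by (simp add: aR)
      finally show ?thesis by (simp add: mult_ac)
    qed
    ultimately show "(\<lambda>n. a n * pochhammer (s / 2) n / of_real R ^ n) sums ((1 - q) powr (- (s / 2)))"
      by simp
    have "(\<lambda>n. ((- (Re s / 2)) gchoose n) * (- norm q) ^ n) sums (1 + (- norm q)) powr (- (Re s / 2))"
      using q by (intro gen_binomial_real) simp
    moreover have "((- (Re s / 2)) gchoose n) * (- norm q) ^ n
         = norm (a n) * pochhammer (Re s / 2) n / Re (of_real R) ^ n" for n
    proof -
      have "((- (Re s / 2)) gchoose n) * (- norm q) ^ n = pochhammer (Re s / 2) n * ((- 1) ^ n * (- norm q) ^ n) / fact n"
        by (simp add: gbinomial_pochhammer)
      also have "(- 1) ^ n * (- norm q) ^ n = norm q ^ n"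
        by (simp flip: power_mult_distrib)
      also have "pochhammer (Re s / 2) n * norm q ^ n / fact n = pochhammer (Re s / 2) n * (norm (a n) / R ^ n)"
        using R by (simp add: a_def q_def norm_divide norm_power power_divide)
      finally show ?thesis by (simp add: mult_ac)
    qed
    ultimately show "summable (\<lambda>n. norm (a n) * pochhammer (Re s / 2) n / Re (of_real R) ^ n)"
      by (simp add: sums_iff)
  qed
  moreover have "gauss_cos (of_real R) 0 s v * exp ((of_real R - A) * of_real (exp (2 * v))) = gauss_cos A 0 s v" for v
    by (simp add: gauss_cos_def exp_add[symmetric] algebra_simps flip: exp_of_real)
  moreover have "of_real R powr (- (s / 2)) * (1 - q) powr (- (s / 2)) = A powr (- (s / 2))"
  proof -
    have "A = of_real R * (1 - q)" using R by (simp add: q_def field_simps)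
    then show ?thesis using R by (simp add: powr_times_real_left)
  qed
  ultimately show ?thesis by (simp add: mult_ac)
qed

lemma summable_hyp1F1:
  fixes \<alpha> u :: real
  assumes "\<alpha> > 0" "u \<ge> 0"
  shows "summable (\<lambda>n. pochhammer \<alpha> n * u ^ n / (pochhammer (1/2) n * fact n))"
proof -
  define f where "f n = pochhammer \<alpha> n * u ^ n / (pochhammer (1/2) n * fact n)" for n
  have pos: "pochhammer (1/2 :: real) n > 0" for n by (rule pochhammer_pos) simp
  have "(\<lambda>n. (\<alpha> + real n) * u / ((1/2 + real n) * (real n + 1))) \<longlonglongrightarrow> 0"
    by real_asymp
  then have "eventually (\<lambda>n. (\<alpha> + real n) * u / ((1/2 + real n) * (real n + 1)) < 1/2) sequentially"
    by (rule order_tendstoD) simp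
  then obtain N where N: "\<And>n. n \<ge> N \<Longrightarrow> (\<alpha> + real n) * u / ((1/2 + real n) * (real n + 1)) < 1/2"
    by (auto simp: eventually_sequentially)
  have nn: "f n \<ge> 0" for n
    using assms pos[of n] by (auto simp: f_def intro!: divide_nonneg_nonneg mult_nonneg_nonneg pochhammer_nonneg)
  have "summable f"
  proof (rule summable_ratio_test[of "1/2" N])
    fix n assume "N \<le> n"
    have "f (Suc n) = f n * ((\<alpha> + real n) * u / ((1/2 + real n) * (real n + 1)))"
      by (simp add: f_def pochhammer_rec' add_ac mult_ac)
    also have "\<dots> \<le> f n * (1/2)"
      using N[OF \<open>N \<le> n\<close>] nn by (intro mult_left_mono) auto
    finally show "norm (f (Suc n)) \<le> 1/2 * norm (f n)" using nn by simp
  qed simp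
  then show ?thesis unfolding f_def .
qed

lemma pochhammer_half_complex: "pochhammer (1/2 :: complex) n = of_real (pochhammer (1/2) n)"
  by (simp flip: pochhammer_of_real)

lemma norm_pochhammer_le:
  fixes a :: complex
  assumes "a \<noteq> 0"
  shows "norm (pochhammer a n) \<le> pochhammer (norm a) n"
proof (induction n)
  case (Suc n)
  have "norm (a + of_nat n) \<le> norm a + real n"
    using norm_triangle_ineq[of a "of_nat n"] by simp
  with Suc assms show ?case
    by (auto simp: pochhammer_Suc norm_mult intro!: mult_mono pochhammer_nonneg)
qed simp

lemma sums_hyp1F1:
  fixes a u :: complex
  assumes "a \<noteq> 0"
  shows "(\<lambda>n. pochhammer a n * u ^ n / (pochhammer (1/2) n * fact n)) sums hyp1F1 a (1/2) u"
proof -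
  have pos: "pochhammer (1/2 :: real) n > 0" for n by (rule pochhammer_pos) simp
  have half: "norm (pochhammer (1/2 :: complex) n) = pochhammer (1/2) n" for n
    using pos[of n] by (simp add: pochhammer_half_complex)
  have "summable (\<lambda>n. pochhammer a n * u ^ n / (pochhammer (1/2) n * fact n))"
  proof (rule summable_comparison_test'[of _ 0])
    show "summable (\<lambda>n. pochhammer (norm a) n * norm u ^ n / (pochhammer (1/2) n * fact n))"
      using assms by (intro summable_hyp1F1) auto
    show "norm (pochhammer a n * u ^ n / (pochhammer (1/2) n * fact n))
      \<le> pochhammer (norm a) n * norm u ^ n / (pochhammer (1/2) n * fact n)" for n
      using pos[of n] norm_pochhammer_le[OF assms, of n] unfolding norm_divide norm_mult norm_power half norm_fact
      by (intro divide_right_mono mult_right_mono) auto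
  qed
  then show ?thesis unfolding hyp1F1_def by (rule summable_sums)
qed

text \<open>
The coefficients of the cosine series satisfy \<open>(2 n)! = 4\<^sup>n n! (1/2)\<^sub>n\<close>, and the weight contributes
\<open>(s/2)\<^sub>n\<close>; together they are the terms of Kummer's function.
\<close>

lemma has_bochner_integral_gauss_cos:
  assumes A: "Re A > 0" and s: "Re s > 0"
  shows "has_bochner_integral lborel (gauss_cos A k s)
           (Gamma (s / 2) * A powr (- (s / 2)) / 2 * hyp1F1 (s / 2) (1 / 2) (- (k\<^sup>2 / (4 * A))))"
proof -
  define a :: "nat \<Rightarrow> complex" where "a n = (- (k\<^sup>2)) ^ n / fact (2 * n)" for n
  have A0: "A \<noteq> 0" using A by auto
  have a_eq: "a n * p / A ^ n = p * (- (k\<^sup>2 / (4 * A))) ^ n / (pochhammer (1 / 2) n * fact n)" for n p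
  proof -
    have "(- (k\<^sup>2 / (4 * A))) ^ n = (- (k\<^sup>2)) ^ n / (4 ^ n * A ^ n)"
      by (metis divide_minus_left power_divide power_mult_distrib)
    moreover have "a n = (- (k\<^sup>2)) ^ n / (4 ^ n * pochhammer (1 / 2) n * fact n)"
      by (simp add: a_def fact_double power_mult)
    ultimately show ?thesis by (simp add: mult_ac)
  qed
  have "has_bochner_integral lborel (\<lambda>v. gauss_cos A 0 s v * cos (k * of_real (exp v)))
      (Gamma (s / 2) * A powr (- (s / 2)) / 2 * hyp1F1 (s / 2) (1 / 2) (- (k\<^sup>2 / (4 * A))))"
  proof (rule has_bochner_integral_exp_double_exp_series[OF A s has_bochner_integral_exp_double_exp[OF A]])
    have term_eq: "a n * of_real (exp (2 * v)) ^ n = (-1) ^ n / fact (2 * n) * (k * of_real (exp v)) ^ (2 * n)" for n v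
    proof -
      have "(- (k\<^sup>2)) ^ n * of_real (exp (2 * v)) ^ n = ((-1) * (k * of_real (exp v))\<^sup>2) ^ n"
        by (simp add: exp_double power_mult_distrib[symmetric])
      also have "\<dots> = (-1) ^ n * (k * of_real (exp v)) ^ (2 * n)"
        by (simp only: power_mult_distrib power_mult)
      finally show ?thesis by (simp add: a_def)
    qed
    show "(\<lambda>n. a n * of_real (exp (2 * v)) ^ n) sums cos (k * of_real (exp v))" for v
    proof -
      let ?f = "\<lambda>n. cos_coeff n *\<^sub>R (k * of_real (exp v)) ^ n"
      have "(\<lambda>n. ?f (2 * n)) sums cos (k * of_real (exp v)) \<longleftrightarrow> ?f sums cos (k * of_real (exp v))"
        by (rule sums_mono_reindex) (auto simp: strict_mono_def cos_coeff_def)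
      then show ?thesis unfolding term_eq
        using cos_converges[of "k * of_real (exp v)"] by (simp add: cos_coeff_def scaleR_conv_of_real)
    qed
    show "summable (\<lambda>n. norm (a n * of_real (exp (2 * v)) ^ n))" for v
    proof -
      let ?f = "\<lambda>n. norm (cos_coeff n *\<^sub>R (k * of_real (exp v)) ^ n)"
      have "summable (\<lambda>n. ?f (2 * n)) \<longleftrightarrow> summable ?f"
        by (rule summable_mono_reindex) (auto simp: strict_mono_def cos_coeff_def)
      then show ?thesis unfolding term_eq
        using summable_norm_cos[of "k * of_real (exp v)"] by (simp add: cos_coeff_def scaleR_conv_of_real norm_mult norm_divide norm_power)
    qed
    show summ: "summable (\<lambda>n. norm (a n) * pochhammer (Re s / 2) n / Re A ^ n)"
    proof -
      have "norm (a n) * pochhammer (Re s / 2) n / Re A ^ n = pochhammer (Re s / 2) n * ((norm k)\<^sup>2 / (4 * Re A)) ^ n / (pochhammer (1/2) n * fact n)" for n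
      proof -
        have half: "norm (pochhammer (1/2 :: complex) n) = pochhammer (1/2) n"
          using pochhammer_pos[of "1/2 :: real" n] by (simp add: pochhammer_half_complex)
        have "norm (a n) = ((norm k)\<^sup>2) ^ n / (4 ^ n * pochhammer (1/2) n * fact n)"
          by (simp add: a_def norm_divide norm_power norm_mult fact_double power_mult half)
        then show ?thesis by (simp add: power_divide power_mult_distrib mult_ac)
      qed
      then show ?thesis using summable_hyp1F1[of "Re s / 2" "(norm k)\<^sup>2 / (4 * Re A)"] A s by simp
    qed
    show "(\<lambda>n. a n * pochhammer (s / 2) n / A ^ n) sums hyp1F1 (s / 2) (1 / 2) (- (k\<^sup>2 / (4 * A)))"
    proof -
      have "s / 2 \<noteq> 0" using s by auto
      then show ?thesis unfolding a_eq by (rule sums_hyp1F1)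
    qed
  qed
  moreover have "(\<lambda>v. gauss_cos A 0 s v * cos (k * of_real (exp v))) = gauss_cos A k s"
    by (simp add: gauss_cos_def fun_eq_iff mult_ac)
  ultimately show ?thesis by simp
qed

section \<open>Fourier inversion\<close>

lemma integrable_lborel_prod:
  fixes f g :: "real \<Rightarrow> complex"
  assumes f: "integrable lborel f" and g: "integrable lborel g"
  shows "integrable (lborel \<Otimes>\<^sub>M lborel) (\<lambda>(x, y). f x * g y)"
proof -
  have [measurable]: "f \<in> borel_measurable borel" "g \<in> borel_measurable borel"
    using f g by (auto dest: borel_measurable_integrable)
  show ?thesis
  proof (rule lborel_pair.Fubini_integrable)
    show "integrable lborel (\<lambda>x. \<integral>y. norm (case (x, y) of (x, y) \<Rightarrow> f x * g y) \<partial>lborel)"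
      using f by (simp add: norm_mult)
  qed (use g in \<open>auto simp: case_prod_unfold\<close>)
qed

lemma integrable_mult_iexp:
  assumes f: "integrable lborel f"
  shows "integrable lborel (\<lambda>v. f v * iexp (t * v))"
proof (rule Bochner_Integration.integrable_bound[OF f])
  show "(\<lambda>v. f v * iexp (t * v)) \<in> borel_measurable lborel"
    using borel_measurable_integrable[OF f] by measurable
qed (simp add: norm_mult)

lemma fourier_multiplication:
  fixes f g :: "real \<Rightarrow> complex"
  assumes f: "integrable lborel f" and g: "integrable lborel g"
  shows "(\<integral>t. g t * (\<integral>v. f v * iexp (t * v) \<partial>lborel) \<partial>lborel)
       = (\<integral>v. f v * (\<integral>t. g t * iexp (v * t) \<partial>lborel) \<partial>lborel)"
proof -
  have [measurable]: "f \<in> borel_measurable borel" "g \<in> borel_measurable borel"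
    using f g by (auto dest: borel_measurable_integrable)
  have "integrable (lborel \<Otimes>\<^sub>M lborel) (\<lambda>(t, v). g t * f v * iexp (t * v))"
    by (rule Bochner_Integration.integrable_bound[OF integrable_lborel_prod[OF g f]])
       (auto simp: norm_mult case_prod_unfold)
  from lborel_pair.Fubini_integral[OF this]
  have "(\<integral>v. (\<integral>t. f v * (g t * iexp (v * t)) \<partial>lborel) \<partial>lborel) = (\<integral>t. (\<integral>v. g t * (f v * iexp (t * v)) \<partial>lborel) \<partial>lborel)"
    by (simp add: mult_ac)
  then show ?thesis by simp
qed

lemma std_normal_density_fourier:
  assumes "e > 0"
  shows "integrable lborel (\<lambda>t. complex_of_real (std_normal_density (e * t)))"
    and "(\<integral>t. complex_of_real (std_normal_density (e * t)) * iexp (v * t) \<partial>lborel) = of_real (exp (- (v / e)\<^sup>2 / 2) / e)"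
proof -
  have i: "integrable lborel std_normal_density"
    using integrable_std_normal_moment[of 0] by simp
  from lborel_integrable_real_affine[OF this, of e 0] assms
  show "integrable lborel (\<lambda>t. complex_of_real (std_normal_density (e * t)))"
    by (intro integrable_of_real) simp
  have "char std_normal_distribution (v / e) = (\<integral>z. complex_of_real (std_normal_density z) * iexp (v / e * z) \<partial>lborel)"
    unfolding char_def by (subst integral_density) (auto simp: scaleR_conv_of_real)
  also have "\<dots> = e * (\<integral>t. complex_of_real (std_normal_density (e * t)) * iexp (v * t) \<partial>lborel)"
    using assms by (subst lborel_integral_real_affine[of e _ 0]) (auto simp: scaleR_conv_of_real)
  finally show "(\<integral>t. complex_of_real (std_normal_density (e * t)) * iexp (v * t) \<partial>lborel) = of_real (exp (- (v / e)\<^sup>2 / 2) / e)"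
    using assms by (simp add: char_std_normal_distribution field_simps)
qed

text \<open>
Gaussian regularisation: against the factor \<open>std_normal_density (e * t)\<close>, the multiplication formula
turns the integral of the transform into an average of \<open>f\<close> over a Gaussian of width \<open>e\<close>. As \<open>e\<close>
tends to \<open>0\<close>, both sides converge dominatedly: the left one since the transform is integrable, the
right one since \<open>f\<close> is bounded and continuous at \<open>0\<close>.
\<close>

lemma fourier_inversion_at_0:
  fixes f :: "real \<Rightarrow> complex"
  assumes f: "integrable lborel f" and cont: "isCont f 0" and bdd: "\<And>v. norm (f v) \<le> B"
    and F: "integrable lborel (\<lambda>t. \<integral>v. f v * iexp (t * v) \<partial>lborel)"
  shows "(\<integral>t. (\<integral>v. f v * iexp (t * v) \<partial>lborel) \<partial>lborel) = 2 * pi * f 0"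
proof -
  define F where "F t = (\<integral>v. f v * iexp (t * v) \<partial>lborel)" for t
  define e where "e n = 1 / real (Suc n)" for n
  have e0: "e n > 0" for n by (simp add: e_def)
  have e_lim: "e \<longlonglongrightarrow> 0" unfolding e_def by (rule LIMSEQ_Suc) (rule lim_1_over_n)
  have intF: "integrable lborel F" using F unfolding F_def .
  have [measurable]: "f \<in> borel_measurable borel" "F \<in> borel_measurable borel"
    using f intF by (auto dest: borel_measurable_integrable)
  have i: "integrable lborel std_normal_density"
    using integrable_std_normal_moment[of 0] by simp
  have key: "(\<integral>t. of_real (std_normal_density (e n * t)) * F t \<partial>lborel)
      = (\<integral>z. of_real (sqrt (2 * pi) * std_normal_density z) * f (e n * z) \<partial>lborel)" for n
  proof -
    have "(\<integral>t. of_real (std_normal_density (e n * t)) * F t \<partial>lborel)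
       = (\<integral>v. f v * of_real (exp (- (v / e n)\<^sup>2 / 2) / e n) \<partial>lborel)"
      unfolding F_def fourier_multiplication[OF f std_normal_density_fourier(1)[OF e0]]
        std_normal_density_fourier(2)[OF e0] ..
    also have "\<dots> = e n *\<^sub>R (\<integral>z. f (e n * z) * of_real (exp (- z\<^sup>2 / 2) / e n) \<partial>lborel)"
      using e0[of n] by (subst lborel_integral_real_affine[of "e n" _ 0]) auto
    also have "\<dots> = (\<integral>z. e n *\<^sub>R (f (e n * z) * of_real (exp (- z\<^sup>2 / 2) / e n)) \<partial>lborel)"
      by simp
    also have "\<dots> = (\<integral>z. of_real (sqrt (2 * pi) * std_normal_density z) * f (e n * z) \<partial>lborel)"
      using e0[of n] by (intro Bochner_Integration.integral_cong) (auto simp: scaleR_conv_of_real std_normal_density_def)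
    finally show ?thesis .
  qed
  have lim1: "(\<lambda>n. \<integral>t. of_real (std_normal_density (e n * t)) * F t \<partial>lborel)
      \<longlonglongrightarrow> (\<integral>t. of_real (1 / sqrt (2 * pi)) * F t \<partial>lborel)"
  proof (rule integral_dominated_convergence)
    show "integrable lborel (\<lambda>t. norm (F t))" using intF by simp
    show "AE t in lborel. (\<lambda>n. of_real (std_normal_density (e n * t)) * F t) \<longlonglongrightarrow> of_real (1 / sqrt (2 * pi)) * F t"
    proof (rule AE_I2)
      fix t
      have "(\<lambda>n. std_normal_density (e n * t)) \<longlonglongrightarrow> std_normal_density (0 * t)"
        unfolding std_normal_density_def by (intro tendsto_intros e_lim) auto
      then show "(\<lambda>n. of_real (std_normal_density (e n * t)) * F t) \<longlonglongrightarrow> of_real (1 / sqrt (2 * pi)) * F t"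
        by (intro tendsto_mult tendsto_of_real tendsto_const) (simp add: std_normal_density_def)
    qed
    have "std_normal_density x \<le> 1" for x
    proof -
      have "1 \<le> sqrt (2 * pi)" using pi_gt3 by simp
      then have "1 / sqrt (2 * pi) * exp (- x\<^sup>2 / 2) \<le> 1 * 1"
        by (intro mult_mono) auto
      then show ?thesis by (simp add: std_normal_density_def)
    qed
    then show "AE t in lborel. norm (of_real (std_normal_density (e n * t)) * F t) \<le> norm (F t)" for n
      by (intro AE_I2) (auto simp: norm_mult intro!: mult_left_le_one_le)
  qed (auto)
  have lim2: "(\<lambda>n. \<integral>z. of_real (sqrt (2 * pi) * std_normal_density z) * f (e n * z) \<partial>lborel)
      \<longlonglongrightarrow> (\<integral>z. of_real (sqrt (2 * pi) * std_normal_density z) * f 0 \<partial>lborel)"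
  proof (rule integral_dominated_convergence)
    show "integrable lborel (\<lambda>z. sqrt (2 * pi) * std_normal_density z * B)" using i by simp
    show "AE z in lborel. (\<lambda>n. of_real (sqrt (2 * pi) * std_normal_density z) * f (e n * z))
        \<longlonglongrightarrow> of_real (sqrt (2 * pi) * std_normal_density z) * f 0"
    proof (intro AE_I2 tendsto_mult tendsto_const isCont_tendsto_compose[OF cont])
      show "(\<lambda>n. e n * z) \<longlonglongrightarrow> 0" for z using tendsto_mult_right[OF e_lim, of z] by simp
    qed
    show "AE z in lborel. norm (of_real (sqrt (2 * pi) * std_normal_density z) * f (e n * z))
        \<le> sqrt (2 * pi) * std_normal_density z * B" for n
      using bdd by (intro AE_I2) (auto simp: norm_mult intro!: mult_left_mono)
  qed auto
  have "(\<integral>z. std_normal_density z \<partial>lborel) = 1"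
    using integral_std_normal_moment_even[of 0] by simp
  then have "(\<integral>z. of_real (sqrt (2 * pi) * std_normal_density z) * f 0 \<partial>lborel) = of_real (sqrt (2 * pi)) * f 0"
    by simp
  moreover have "(\<integral>t. of_real (1 / sqrt (2 * pi)) * F t \<partial>lborel) = (\<integral>z. of_real (sqrt (2 * pi) * std_normal_density z) * f 0 \<partial>lborel)"
    using LIMSEQ_unique[OF lim1] lim2 unfolding key by blast
  ultimately have "of_real (1 / sqrt (2 * pi)) * integral\<^sup>L lborel F = of_real (sqrt (2 * pi)) * f 0"
    by simp
  then have "of_real (sqrt (2 * pi)) * (of_real (1 / sqrt (2 * pi)) * integral\<^sup>L lborel F) = of_real (sqrt (2 * pi)) * (of_real (sqrt (2 * pi)) * f 0)"
    by simp
  moreover have "of_real (sqrt (2 * pi)) * of_real (sqrt (2 * pi)) = complex_of_real (2 * pi)"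
    by (simp flip: of_real_mult)
  ultimately have "integral\<^sup>L lborel F = 2 * pi * f 0"
    by (simp add: mult.assoc[symmetric] flip: of_real_mult)
  then show ?thesis unfolding F_def .
qed

text \<open>
The value at \<open>0\<close> of the convolution of \<open>f\<close> and \<open>g\<close>, recovered from the product of their transforms.
The hypotheses are asymmetric because inversion evaluates \<open>f\<close> pointwise, while \<open>g\<close> is only
integrated.
\<close>

lemma fourier_parseval:
  fixes f g :: "real \<Rightarrow> complex"
  assumes f: "integrable lborel f" and cont: "continuous_on UNIV f" and bdd: "\<And>v. norm (f v) \<le> B"
    and F: "integrable lborel (\<lambda>t. \<integral>v. f v * iexp (t * v) \<partial>lborel)"
    and g: "integrable lborel g"
  shows "(\<integral>t. (\<integral>v. f v * iexp (t * v) \<partial>lborel) * (\<integral>v. g v * iexp (t * v) \<partial>lborel) \<partial>lborel)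
     = 2 * pi * (\<integral>v. g v * f (- v) \<partial>lborel)"
proof -
  define F where "F t = (\<integral>v. f v * iexp (t * v) \<partial>lborel)" for t
  have inv: "(\<integral>t. F t * iexp (u * t) \<partial>lborel) = 2 * pi * f (- u)" for u
  proof -
    define h where "h v = f (v - u)" for v
    have h: "integrable lborel h"
      using lborel_integrable_real_affine[OF f, of 1 "- u"] by (simp add: h_def[abs_def] add.commute)
    have H: "(\<integral>v. h v * iexp (t * v) \<partial>lborel) = F t * iexp (u * t)" for t
    proof -
      have "(\<integral>v. h v * iexp (t * v) \<partial>lborel) = (\<integral>v. (f v * iexp (t * v)) * iexp (u * t) \<partial>lborel)"
        by (subst lborel_integral_real_affine[of 1 _ u])
           (auto simp: h_def algebra_simps exp_add[symmetric] intro!: Bochner_Integration.integral_cong)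
      also have "\<dots> = F t * iexp (u * t)" unfolding F_def by simp
      finally show ?thesis .
    qed
    have "(\<integral>t. (\<integral>v. h v * iexp (t * v) \<partial>lborel) \<partial>lborel) = 2 * pi * h 0"
    proof (rule fourier_inversion_at_0[OF h])
      have "continuous_on UNIV h"
        unfolding h_def by (intro continuous_on_compose2[OF cont] continuous_intros) auto
      then show "isCont h 0" by (simp add: continuous_on_eq_continuous_at)
      show "norm (h v) \<le> B" for v unfolding h_def by (rule bdd)
      show "integrable lborel (\<lambda>t. \<integral>v. h v * iexp (t * v) \<partial>lborel)"
        unfolding H by (rule integrable_mult_iexp) (use F in \<open>simp add: F_def\<close>)
    qed
    then show ?thesis unfolding H by (simp add: h_def)
  qed
  have "(\<integral>t. F t * (\<integral>v. g v * iexp (t * v) \<partial>lborel) \<partial>lborel) = (\<integral>v. g v * (\<integral>t. F t * iexp (v * t) \<partial>lborel) \<partial>lborel)"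
    by (rule fourier_multiplication[OF g]) (use F in \<open>simp add: F_def\<close>)
  also have "\<dots> = (\<integral>v. 2 * pi * (g v * f (- v)) \<partial>lborel)"
    unfolding inv by (simp add: mult_ac)
  finally show ?thesis unfolding F_def by simp
qed

section \<open>The Mellin--Barnes integral as a convolution\<close>

lemma norm_gauss_cos_le:
  assumes "norm k \<le> \<kappa>"
  shows "norm (gauss_cos A k s v) \<le> exp (- (Re A * exp (2 * v)) + \<kappa> * exp v + Re s * v)"
proof -
  have "norm (cos (k * of_real (exp v))) \<le> exp (norm (k * of_real (exp v)))"
    by (rule norm_cos_le)
  also have "\<dots> \<le> exp (\<kappa> * exp v)"
    using assms by (simp add: norm_mult mult_right_mono)
  finally have "norm (cos (k * of_real (exp v))) \<le> exp (\<kappa> * exp v)" .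
  moreover have "norm (exp (- (A * of_real (exp (2 * v))))) = exp (- (Re A * exp (2 * v)))"
    "norm (exp (s * of_real v)) = exp (Re s * v)" by simp_all
  ultimately show ?thesis
    unfolding gauss_cos_def norm_mult exp_add by (simp add: mult_left_mono mult_right_mono del: norm_exp_eq_Re)
qed

text \<open>
The majorant for \<open>gauss_cos\<close> and for its product with a hyperbolic cosine in \<open>exp v\<close>. It is dominated by \<open>gauss_cos\<close> with an imaginary
frequency, where the cosine becomes a hyperbolic cosine, so its integrability is already known.
\<close>

lemma integrable_gauss_bound:
  fixes \<rho> \<kappa> c :: real
  assumes "\<rho> > 0" "c > 0"
  shows "integrable lborel (\<lambda>v. exp (- (\<rho> * exp (2 * v)) + \<kappa> * exp v + c * v))"
proof (rule Bochner_Integration.integrable_bound)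
  show "integrable lborel (\<lambda>v. 2 * gauss_cos (of_real \<rho>) (\<i> * of_real \<kappa>) (of_real c) v)"
    using has_bochner_integral_gauss_cos[of "of_real \<rho>" "of_real c" "\<i> * of_real \<kappa>"] assms
    by (simp add: has_bochner_integral_iff)
  show "AE v in lborel. norm (exp (- (\<rho> * exp (2 * v)) + \<kappa> * exp v + c * v))
      \<le> norm (2 * gauss_cos (of_real \<rho>) (\<i> * of_real \<kappa>) (of_real c) v)"
  proof (rule AE_I2)
    fix v :: real
    have "cos (\<i> * of_real \<kappa> * of_real (exp v)) = complex_of_real (cosh (\<kappa> * exp v))"
      using cosh_conv_cos[of "of_real (\<kappa> * exp v)", symmetric]
      by (simp add: mult.assoc cosh_field_def exp_minus flip: exp_of_real)
    then have "norm (2 * gauss_cos (of_real \<rho>) (\<i> * of_real \<kappa>) (of_real c) v)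
       = exp (- (\<rho> * exp (2 * v))) * (2 * cosh (\<kappa> * exp v)) * exp (c * v)"
      unfolding gauss_cos_def norm_mult by simp
    moreover have "exp (\<kappa> * exp v) \<le> 2 * cosh (\<kappa> * exp v)"
      by (simp add: cosh_field_def)
    moreover have "norm (exp (- (\<rho> * exp (2 * v)) + \<kappa> * exp v + c * v))
        = exp (- (\<rho> * exp (2 * v))) * exp (\<kappa> * exp v) * exp (c * v)"
      by (simp flip: exp_add)
    ultimately show "norm (exp (- (\<rho> * exp (2 * v)) + \<kappa> * exp v + c * v))
      \<le> norm (2 * gauss_cos (of_real \<rho>) (\<i> * of_real \<kappa>) (of_real c) v)"
      by (metis exp_ge_zero mult_left_mono mult_right_mono)
  qed
qed simp

lemma neg_quadratic_le_max:
  fixes \<rho> b r :: real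
  assumes "\<rho> > 0"
  shows "- (\<rho> * r\<^sup>2) + b * r \<le> b\<^sup>2 / (4 * \<rho>)"
proof -
  have "b\<^sup>2 / (4 * \<rho>) - (- (\<rho> * r\<^sup>2) + b * r) = \<rho> * (r - b / (2 * \<rho>))\<^sup>2"
    using assms by (simp add: field_simps power2_eq_square)
  then show ?thesis using assms by (smt (verit) mult_nonneg_nonneg zero_le_power2)
qed

lemma gauss_cos_bounded:
  assumes "Re A > 0" "Re s \<ge> 0"
  shows "norm (gauss_cos A k s v) \<le> exp ((norm k + Re s)\<^sup>2 / (4 * Re A))"
proof -
  have "v \<le> exp v" using exp_ge_add_one_self[of v] by linarith
  then have "Re s * v \<le> Re s * exp v" using assms by (intro mult_left_mono)
  moreover have "- (Re A * exp (2 * v)) + (norm k + Re s) * exp v \<le> (norm k + Re s)\<^sup>2 / (4 * Re A)"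
    using neg_quadratic_le_max[OF assms(1), of "exp v" "norm k + Re s"] by (simp add: exp_double)
  ultimately have "- (Re A * exp (2 * v)) + norm k * exp v + Re s * v \<le> (norm k + Re s)\<^sup>2 / (4 * Re A)"
    by (simp add: algebra_simps)
  with norm_gauss_cos_le[OF order_refl, of A k s v] show ?thesis
    by (meson exp_le_cancel_iff order_trans)
qed

lemma Re_exp_double_pos:
  assumes "\<bar>Im L\<bar> < pi / 4"
  shows "Re (exp (2 * L)) > 0"
proof -
  have "cos (2 * Im L) > 0" using assms by (intro cos_gt_zero_pi) auto
  then show ?thesis by (simp add: Re_exp)
qed

text \<open>
With \<open>x = exp L\<close>, replacing \<open>r\<close> by \<open>x r\<close> multiplies the transform by \<open>x powr (- s)\<close>. This scaling
holds for complex \<open>x\<close> as long as \<open>\<bar>Im L\<bar> < pi / 4\<close> keeps \<open>x\<^sup>2\<close> in the right half-plane, because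
the argument \<open>- k\<^sup>2 / (4 A)\<close> of Kummer's function does not change.
\<close>

lemma has_bochner_integral_gauss_cos_rotated:
  assumes L: "\<bar>Im L\<bar> < pi / 4" and s: "Re s > 0"
  shows "has_bochner_integral lborel (gauss_cos (exp (2 * L)) (w * exp L) s)
           (Gamma (s / 2) * hyp1F1 (s / 2) (1 / 2) (- (w\<^sup>2 / 4)) * exp (- s * L) / 2)"
proof -
  have "Ln (exp (2 * L)) = 2 * L" using L by (intro Ln_exp) auto
  then have "exp (2 * L) powr (- (s / 2)) = exp (- s * L)"
    by (simp add: powr_def)
  moreover have "(w * exp L)\<^sup>2 / (4 * exp (2 * L)) = w\<^sup>2 / 4"
    by (simp add: exp_double power_mult_distrib)
  ultimately show ?thesis
    using has_bochner_integral_gauss_cos[OF Re_exp_double_pos[OF L] s, of "w * exp L"]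
    by (simp only: mult_ac times_divide_eq_left times_divide_eq_right)
qed

definition gauss_transform :: "complex \<Rightarrow> complex \<Rightarrow> real \<Rightarrow> real \<Rightarrow> complex" where
  "gauss_transform w L c t = (\<integral>v. gauss_cos (exp (2 * L)) (w * exp L) (of_real c) v * iexp (t * v) \<partial>lborel)"

lemma gauss_cos_Complex: "gauss_cos A k (Complex c t) v = gauss_cos A k (of_real c) v * iexp (t * v)"
proof -
  have "Complex c t * of_real v = of_real c * of_real v + \<i> * of_real (t * v)"
    by (simp add: complex_eq_iff)
  then show ?thesis by (simp add: gauss_cos_def exp_add mult_ac)
qed

lemma gauss_transform_eq:
  assumes "\<bar>Im L\<bar> < pi / 4" "c > 0"
  shows "gauss_transform w L c t = Gamma (Complex c t / 2) * hyp1F1 (Complex c t / 2) (1 / 2) (- (w\<^sup>2 / 4))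
           * exp (- Complex c t * L) / 2"
  using has_bochner_integral_gauss_cos_rotated[OF assms(1), of "Complex c t" w] assms(2)
  unfolding gauss_transform_def gauss_cos_Complex[symmetric]
  by (simp add: has_bochner_integral_iff)

lemma gauss_transform_bounded:
  "norm (gauss_transform w L c t)
     \<le> (\<integral>v. norm (gauss_cos (exp (2 * L)) (w * exp L) (of_real c) v) \<partial>lborel)"
  unfolding gauss_transform_def by (rule order_trans[OF integral_norm_bound]) (simp add: norm_mult)

text \<open>
Tilting \<open>L\<close> to \<open>L + \<i> \<epsilon>\<close> multiplies the transform at \<open>c + \<i> t\<close> by \<open>exp (- \<i> \<epsilon> (c + \<i> t))\<close>, of
modulus \<open>exp (\<epsilon> t)\<close>, while the tilted transform is still bounded. As the sector is open, a small
\<open>\<epsilon>\<close> of either sign is available, which gives exponential decay in both directions without any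
asymptotics of the Gamma function.
\<close>

lemma gauss_transform_decay:
  assumes L: "\<bar>Im L\<bar> < pi / 4" and c: "c > 0"
  obtains C \<delta> where "\<delta> > 0" "\<And>t. norm (gauss_transform w L c t) \<le> C * exp (- (\<delta> * \<bar>t\<bar>))"
proof -
  \<comment> \<open>Half of the distance to the boundary of the sector, so that both tilts stay inside.\<close>
  define \<delta> where "\<delta> = (pi / 4 - \<bar>Im L\<bar>) / 2"
  have \<delta>: "\<delta> > 0" using L by (simp add: \<delta>_def)
  define N where "N M = (\<integral>v. norm (gauss_cos (exp (2 * M)) (w * exp M) (of_real c) v) \<partial>lborel)" for M
  have shift: "norm (gauss_transform w L c t) \<le> exp (- (\<epsilon> * t)) * N (L + \<i> * of_real \<epsilon>)" if "\<bar>\<epsilon>\<bar> \<le> \<delta>" for \<epsilon> t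
  proof -
    have "\<bar>Im L + \<epsilon>\<bar> < pi / 4" using that L unfolding \<delta>_def by (simp add: field_simps abs_if split: if_splits)
    then have "gauss_transform w (L + \<i> * of_real \<epsilon>) c t
        = gauss_transform w L c t * exp (- Complex c t * (\<i> * of_real \<epsilon>))"
      using L c by (simp add: gauss_transform_eq exp_add[symmetric] algebra_simps)
    moreover have "norm (exp (- Complex c t * (\<i> * of_real \<epsilon>))) = exp (\<epsilon> * t)"
      by (simp add: mult.commute)
    ultimately have "norm (gauss_transform w L c t) * exp (\<epsilon> * t) \<le> N (L + \<i> * of_real \<epsilon>)"
      using gauss_transform_bounded[of w "L + \<i> * of_real \<epsilon>" c t] unfolding N_def by (simp only: norm_mult)
    then show ?thesis by (simp add: exp_minus field_simps)
  qed
  define C where "C = max (N (L + \<i> * of_real \<delta>)) (N (L + \<i> * of_real (- \<delta>)))"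
  have "norm (gauss_transform w L c t) \<le> C * exp (- (\<delta> * \<bar>t\<bar>))" for t
  proof (cases "t \<ge> 0")
    case True
    have "norm (gauss_transform w L c t) \<le> exp (- (\<delta> * t)) * N (L + \<i> * of_real \<delta>)"
      using \<delta> by (intro shift) auto
    also have "\<dots> \<le> exp (- (\<delta> * t)) * C" by (intro mult_left_mono) (auto simp: C_def)
    finally show ?thesis using True by (simp add: mult.commute)
  next
    case False
    have "norm (gauss_transform w L c t) \<le> exp (- (- \<delta> * t)) * N (L + \<i> * of_real (- \<delta>))"
      using \<delta> by (intro shift) auto
    also have "\<dots> \<le> exp (- (- \<delta> * t)) * C" by (intro mult_left_mono) (auto simp: C_def)
    finally show ?thesis using False by (simp add: mult.commute)
  qed
  with \<delta> that show ?thesis by blast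
qed

lemma integrable_exp_abs:
  assumes "\<delta> > 0"
  shows "integrable lborel (\<lambda>t::real. exp (- (\<delta> * \<bar>t\<bar>)))"
proof (rule Bochner_Integration.integrable_bound)
  show "integrable lborel (\<lambda>t::real. (1 + 2 / \<delta>\<^sup>2) * inverse (1 + t\<^sup>2))"
    using integrable_inverse_1_plus_square by (simp add: set_integrable_def einterval_def)
  show "AE t in lborel. norm (exp (- (\<delta> * \<bar>t\<bar>))) \<le> norm ((1 + 2 / \<delta>\<^sup>2) * inverse (1 + t\<^sup>2))"
  proof (rule AE_I2)
    fix t :: real
    have "1 + \<delta> * \<bar>t\<bar> + (\<delta> * \<bar>t\<bar>)\<^sup>2 / 2 \<le> exp (\<delta> * \<bar>t\<bar>)"
      using assms by (intro exp_lower_Taylor_quadratic) auto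
    then have e: "1 + \<delta>\<^sup>2 * t\<^sup>2 / 2 \<le> exp (\<delta> * \<bar>t\<bar>)"
      using assms by (simp add: power_mult_distrib) (smt (verit) abs_ge_zero mult_nonneg_nonneg)
    have "1 + t\<^sup>2 \<le> (1 + 2 / \<delta>\<^sup>2) * (1 + \<delta>\<^sup>2 * t\<^sup>2 / 2)"
      using assms by (simp add: field_simps)
    also have "\<dots> \<le> (1 + 2 / \<delta>\<^sup>2) * exp (\<delta> * \<bar>t\<bar>)"
      by (intro mult_left_mono e) auto
    finally have "exp (- (\<delta> * \<bar>t\<bar>)) * (1 + t\<^sup>2) \<le> 1 + 2 / \<delta>\<^sup>2"
      by (simp add: exp_minus field_simps)
    then have "exp (- (\<delta> * \<bar>t\<bar>)) \<le> (1 + 2 / \<delta>\<^sup>2) * inverse (1 + t\<^sup>2)"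
      by (simp add: field_simps add_pos_nonneg)
    moreover have "0 \<le> (1 + 2 / \<delta>\<^sup>2) * inverse (1 + t\<^sup>2)" by simp
    ultimately show "norm (exp (- (\<delta> * \<bar>t\<bar>))) \<le> norm ((1 + 2 / \<delta>\<^sup>2) * inverse (1 + t\<^sup>2))"
      by simp
  qed
qed simp

lemma gauss_transform_measurable [measurable]: "gauss_transform w L c \<in> borel_measurable borel"
  unfolding gauss_transform_def[abs_def]
  by (intro lborel.borel_measurable_lebesgue_integral) (simp add: case_prod_unfold)

lemma integrable_gauss_transform:
  assumes L: "\<bar>Im L\<bar> < pi / 4" and c: "c > 0"
  shows "integrable lborel (gauss_transform w L c)"
proof -
  obtain C \<delta> where *: "\<delta> > 0" "\<And>t. norm (gauss_transform w L c t) \<le> C * exp (- (\<delta> * \<bar>t\<bar>))"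
    using gauss_transform_decay[OF assms] by metis
  show ?thesis
  proof (rule Bochner_Integration.integrable_bound)
    show "integrable lborel (\<lambda>t. C * exp (- (\<delta> * \<bar>t\<bar>)))"
      using integrable_exp_abs[OF *(1)] by simp
    show "AE t in lborel. norm (gauss_transform w L c t) \<le> norm (C * exp (- (\<delta> * \<bar>t\<bar>)))"
      by (intro AE_I2 order_trans[OF *(2)]) simp
  qed simp
qed

text \<open>
The factor \<open>2 powr (s - 2)\<close> is \<open>(1 / 2) powr (- s) / 4\<close>: it provides the scaling of a second transform,
taken at \<open>x = 1 / 2\<close>, together with the two factors \<open>1 / 2\<close> that the transforms carry.
\<close>

lemma gen_bessel_integrand_eq:
  assumes x: "x \<noteq> 0" and arg: "\<bar>Arg x\<bar> < pi / 4" and c: "c > 0"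
  shows "gen_bessel_integrand 0 w x (Complex c t)
     = gauss_transform w (of_real (- ln 2)) c t * gauss_transform w (Ln x) c t"
proof -
  have "2 powr (Complex c t - 2) = exp (- Complex c t * of_real (- ln 2)) / (4 :: complex)"
  proof -
    have "Ln 2 = complex_of_real (ln 2)" using Ln_of_real[of 2] by simp
    then have "2 powr Complex c t = exp (- Complex c t * of_real (- ln 2))"
      by (simp add: powr_def)
    moreover have "(2 :: complex) powr 2 = 4" using powr_nat'[of "2 :: complex" 2] by simp
    ultimately show ?thesis by (simp add: powr_diff)
  qed
  moreover have "x powr (- Complex c t) = exp (- Complex c t * Ln x)"
    using x by (simp add: powr_def)
  moreover have "\<bar>Im (Ln x)\<bar> < pi / 4" using x arg by (simp add: Arg_eq_Im_Ln)
  ultimately show ?thesis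
    using c by (simp add: gen_bessel_integrand_def gauss_transform_eq)
qed

text \<open>
The Mellin--Barnes integral is the inverse transform of a product, hence a multiplicative convolution;
the factors \<open>exp (c v)\<close> and \<open>exp (- c v)\<close> cancel, which shows the independence of \<open>c\<close>. In terms of \<open>r = exp v\<close> the
right-hand side is the integral of
\<open>exp (- x\<^sup>2 r\<^sup>2 - 1 / (4 r\<^sup>2)) cos (w x r) cos (w / (2 r)) / r\<close> over \<open>r > 0\<close>.
\<close>

lemma gen_bessel_K_eq:
  assumes x: "x \<noteq> 0" and arg: "\<bar>Arg x\<bar> < pi / 4" and c: "c > 0"
  shows "integrable lborel (\<lambda>t. gen_bessel_integrand 0 w x (Complex c t))"
    and "gen_bessel_K c 0 w x = (\<integral>v. gauss_cos (x\<^sup>2) (w * x) 0 v * gauss_cos (1 / 4) (w / 2) 0 (- v) \<partial>lborel)"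
proof -
  define H where "H = complex_of_real (- ln 2)"
  define f where "f = gauss_cos (exp (2 * H)) (w * exp H) (of_real c)"
  define g where "g = gauss_cos (exp (2 * Ln x)) (w * exp (Ln x)) (of_real c)"
  have H: "\<bar>Im H\<bar> < pi / 4" by (simp add: H_def)
  have Lx: "\<bar>Im (Ln x)\<bar> < pi / 4" using x arg by (simp add: Arg_eq_Im_Ln)
  have eH: "exp H = 1 / 2" by (simp add: H_def exp_of_real exp_minus)
  have f: "integrable lborel f" and g: "integrable lborel g"
    using has_bochner_integral_gauss_cos_rotated[OF H, of "of_real c" w]
      has_bochner_integral_gauss_cos_rotated[OF Lx, of "of_real c" w] c
    by (auto simp: f_def g_def has_bochner_integral_iff)
  have F: "gauss_transform w H c = (\<lambda>t. \<integral>v. f v * iexp (t * v) \<partial>lborel)"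
    and G: "gauss_transform w (Ln x) c = (\<lambda>t. \<integral>v. g v * iexp (t * v) \<partial>lborel)"
    by (simp_all add: gauss_transform_def f_def g_def fun_eq_iff)
  show "integrable lborel (\<lambda>t. gen_bessel_integrand 0 w x (Complex c t))"
  proof (rule Bochner_Integration.integrable_bound)
    define B where "B = (\<integral>v. norm (g v) \<partial>lborel)"
    show "integrable lborel (\<lambda>t. of_real B * gauss_transform w H c t)"
      using integrable_gauss_transform[OF H c] by simp
    have "norm (gauss_transform w (Ln x) c t) \<le> \<bar>B\<bar>" for t
      using gauss_transform_bounded[of w "Ln x" c t] unfolding B_def g_def by linarith
    then show "AE t in lborel. norm (gen_bessel_integrand 0 w x (Complex c t)) \<le> norm (of_real B * gauss_transform w H c t)"
      unfolding gen_bessel_integrand_eq[OF assms] H_def[symmetric]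
      by (intro AE_I2) (auto simp: norm_mult mult.commute[of "\<bar>B\<bar>"] intro!: mult_left_mono)
  qed (simp add: gen_bessel_integrand_eq[OF assms])
  have "(\<integral>t. gen_bessel_integrand 0 w x (Complex c t) \<partial>lborel) = 2 * pi * (\<integral>v. g v * f (- v) \<partial>lborel)"
    unfolding gen_bessel_integrand_eq[OF assms] H_def[symmetric] F G
  proof (rule fourier_parseval[OF f _ _ _ g])
    show "continuous_on UNIV f" unfolding f_def by (rule continuous_on_gauss_cos)
    show "norm (f v) \<le> exp ((norm (w * exp H) + Re (of_real c))\<^sup>2 / (4 * Re (exp (2 * H))))" for v
      unfolding f_def using c by (intro gauss_cos_bounded Re_exp_double_pos H) simp
    show "integrable lborel (\<lambda>t. \<integral>v. f v * iexp (t * v) \<partial>lborel)"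
      using integrable_gauss_transform[OF H c, of w] unfolding F .
  qed
  then have "gen_bessel_K c 0 w x = (\<integral>v. g v * f (- v) \<partial>lborel)"
    by (simp add: gen_bessel_K_def)
  also have "(\<lambda>v. g v * f (- v)) = (\<lambda>v. gauss_cos (x\<^sup>2) (w * x) 0 v * gauss_cos (1 / 4) (w / 2) 0 (- v))"
  proof
    fix v
    have e: "exp (2 * H) = 1 / 4" "exp (2 * Ln x) = x\<^sup>2" "exp (Ln x) = x"
      using x unfolding exp_double eH by (simp_all add: power_divide)
    have "exp (of_real c * of_real v) * exp (of_real c * of_real (- v)) = (1 :: complex)"
      by (simp flip: exp_add)
    then show "g v * f (- v) = gauss_cos (x\<^sup>2) (w * x) 0 v * gauss_cos (1 / 4) (w / 2) 0 (- v)"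
      unfolding f_def g_def gauss_cos_def e eH by (simp add: mult_ac)
  qed
  finally show "gen_bessel_K c 0 w x = (\<integral>v. gauss_cos (x\<^sup>2) (w * x) 0 v * gauss_cos (1 / 4) (w / 2) 0 (- v) \<partial>lborel)" .
qed

section \<open>Gaussian representation of the kernel\<close>

lemma hyp1F1_half_half: "hyp1F1 (1 / 2) (1 / 2) u = exp u"
proof -
  have "pochhammer (1 / 2 :: complex) n \<noteq> 0" for n
    using pochhammer_pos[of "1/2 :: real" n] by (simp add: pochhammer_half_complex)
  then have "pochhammer (1 / 2) n * u ^ n / (pochhammer (1 / 2) n * fact n) = u ^ n /\<^sub>R fact n" for n
    by (simp add: scaleR_conv_of_real field_simps)
  then show ?thesis by (simp add: hyp1F1_def exp_def)
qed

text \<open>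
At \<open>s = 1\<close> Kummer's function degenerates to the exponential and the Mellin transform is the
Fourier cosine transform of a Gaussian.
\<close>

lemma has_bochner_integral_gaussian_cos:
  assumes "Re A > 0"
  shows "has_bochner_integral lborel (gauss_cos A k 1)
           (of_real (sqrt pi) / (2 * csqrt A) * exp (- (k\<^sup>2 / (4 * A))))"
proof -
  have "A powr (- (1 / 2)) = 1 / csqrt A"
    by (simp add: csqrt_conv_powr powr_minus_divide)
  then show ?thesis
    using has_bochner_integral_gauss_cos[OF assms, of 1 k]
    by (simp add: hyp1F1_half_half Gamma_one_half_complex mult.commute)
qed

text \<open>
The kernel of the theorem is itself a Gaussian integral, with \<open>A = x\<^sup>2 + u\<^sup>2\<close>. The product of
\<open>cos (w x r)\<close> and \<open>cosh (w u r) = cos (\<i> w u r)\<close> is the mean of the cosines with frequencies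
\<open>w (x + \<i> u)\<close> and \<open>w (x - \<i> u)\<close>; completing the square for each of them produces \<open>exp (w\<^sup>2 / 4)\<close>, the exponential of
the kernel and one of \<open>exp (- \<i> \<phi>)\<close> and \<open>exp (\<i> \<phi>)\<close>, whose mean is the cosine of the kernel.
\<close>

lemma has_bochner_integral_kernel:
  assumes x: "Re (x\<^sup>2) > 0"
  shows "has_bochner_integral lborel
     (\<lambda>v. gauss_cos (x\<^sup>2) (w * x) 1 v *
        (exp (- (of_real (u * exp v))\<^sup>2) * cos (\<i> * w * of_real (u * exp v))))
     (of_real (sqrt pi) / 2 * exp (w\<^sup>2 / 4) *
       (exp (- (w\<^sup>2 * x\<^sup>2 / (2 * (x\<^sup>2 + (of_real u)\<^sup>2))))
        * cos (w\<^sup>2 * x * of_real u / (2 * (x\<^sup>2 + (of_real u)\<^sup>2)))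
        / csqrt (x\<^sup>2 + (of_real u)\<^sup>2)))"
proof -
  define A where "A = x\<^sup>2 + (of_real u)\<^sup>2"
  have A: "Re A > 0" using x by (simp add: A_def flip: of_real_power)
      (simp add: add_pos_nonneg)
  then have A0: "A \<noteq> 0" by auto
  define k1 where "k1 = w * (x + \<i> * of_real u)"
  define k2 where "k2 = w * (x - \<i> * of_real u)"
  define \<phi> where "\<phi> = w\<^sup>2 * x * of_real u / (2 * A)"
  define E where "E = exp (- (w\<^sup>2 * x\<^sup>2 / (2 * A)))"
  have k1: "exp (- (k1\<^sup>2 / (4 * A))) = exp (w\<^sup>2 / 4) * E * exp (- (\<i> * \<phi>))"
  proof -
    have k_eq: "k1\<^sup>2 = w\<^sup>2 * (2 * x\<^sup>2 - A + 2 * \<i> * x * of_real u)"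
      by (simp add: k1_def A_def power2_eq_square algebra_simps)
    have "- (k1\<^sup>2 / (4 * A)) = w\<^sup>2 / 4 + (- (w\<^sup>2 * x\<^sup>2 / (2 * A))) + (- (\<i> * \<phi>))"
      unfolding k_eq using A0 by (simp add: \<phi>_def field_simps)
    then show ?thesis by (simp only: E_def exp_add)
  qed
  have k2: "exp (- (k2\<^sup>2 / (4 * A))) = exp (w\<^sup>2 / 4) * E * exp (\<i> * \<phi>)"
  proof -
    have k_eq: "k2\<^sup>2 = w\<^sup>2 * (2 * x\<^sup>2 - A - 2 * \<i> * x * of_real u)"
      by (simp add: k2_def A_def power2_eq_square algebra_simps)
    have "- (k2\<^sup>2 / (4 * A)) = w\<^sup>2 / 4 + (- (w\<^sup>2 * x\<^sup>2 / (2 * A))) + (\<i> * \<phi>)"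
      unfolding k_eq using A0 by (simp add: \<phi>_def field_simps)
    then show ?thesis by (simp only: E_def exp_add)
  qed
  have "has_bochner_integral lborel (\<lambda>v. (gauss_cos A k1 1 v + gauss_cos A k2 1 v) / 2)
      ((of_real (sqrt pi) / (2 * csqrt A) * exp (- (k1\<^sup>2 / (4 * A)))
       + of_real (sqrt pi) / (2 * csqrt A) * exp (- (k2\<^sup>2 / (4 * A)))) / 2)"
    by (intro has_bochner_integral_divide_zero has_bochner_integral_add has_bochner_integral_gaussian_cos A)
  also have "(of_real (sqrt pi) / (2 * csqrt A) * exp (- (k1\<^sup>2 / (4 * A)))
       + of_real (sqrt pi) / (2 * csqrt A) * exp (- (k2\<^sup>2 / (4 * A)))) / 2
      = of_real (sqrt pi) / 2 * exp (w\<^sup>2 / 4) * (E * cos \<phi> / csqrt A)"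
    unfolding k1 k2 cos_exp_eq using A0 by (simp add: field_simps)
  also have "(\<lambda>v. (gauss_cos A k1 1 v + gauss_cos A k2 1 v) / 2) = (\<lambda>v. gauss_cos (x\<^sup>2) (w * x) 1 v *
        (exp (- (of_real (u * exp v))\<^sup>2) * cos (\<i> * w * of_real (u * exp v))))"
  proof
    fix v
    let ?r = "of_real (exp v) :: complex"
    have "exp (- (A * of_real (exp (2 * v)))) = exp (- (x\<^sup>2 * of_real (exp (2 * v)))) * exp (- (of_real (u * exp v))\<^sup>2)"
    proof -
      have "complex_of_real (exp (2 * v)) = ?r\<^sup>2" by (simp add: exp_double)
      then show ?thesis
        by (simp add: A_def power_mult_distrib algebra_simps flip: exp_add)
    qed
    moreover have "(cos (k1 * ?r) + cos (k2 * ?r)) / 2 = cos (w * x * ?r) * cos (\<i> * w * of_real (u * exp v))"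
    proof -
      have "k1 * ?r = w * x * ?r + \<i> * w * of_real (u * exp v)" "k2 * ?r = w * x * ?r - \<i> * w * of_real (u * exp v)"
        by (simp_all add: k1_def k2_def algebra_simps)
      then show ?thesis by (simp add: cos_add cos_diff)
    qed
    moreover have "(gauss_cos A k1 1 v + gauss_cos A k2 1 v) / 2
        = exp (- (A * of_real (exp (2 * v)))) * ((cos (k1 * ?r) + cos (k2 * ?r)) / 2) * exp (1 * of_real v)"
      unfolding gauss_cos_def by (simp add: algebra_simps add_divide_distrib)
    ultimately show "(gauss_cos A k1 1 v + gauss_cos A k2 1 v) / 2 = gauss_cos (x\<^sup>2) (w * x) 1 v *
        (exp (- (of_real (u * exp v))\<^sup>2) * cos (\<i> * w * of_real (u * exp v)))"
      unfolding gauss_cos_def by (simp only: mult_ac)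
  qed
  finally show ?thesis unfolding E_def \<phi>_def A_def .
qed

section \<open>Truncated cosine integrals\<close>

lemma norm_sin_le_exp:
  fixes z :: complex
  shows "norm (sin z) \<le> exp (norm z)"
proof -
  have "norm (sin z) = norm (exp (\<i> * z) - exp (- (\<i> * z))) / 2"
    by (simp add: sin_exp_eq norm_divide norm_mult)
  also have "\<dots> \<le> (norm (exp (\<i> * z)) + norm (exp (- (\<i> * z)))) / 2"
    by (intro divide_right_mono norm_triangle_ineq4) auto
  also have "\<dots> \<le> (exp (norm z) + exp (norm z)) / 2"
    using norm_exp[of "\<i> * z"] norm_exp[of "- (\<i> * z)"]
    by (intro divide_right_mono add_mono) (auto simp: norm_mult)
  finally show ?thesis by simp
qed

text \<open>
The Fourier cosine integral, at frequency \<open>1\<close>, of \<open>exp (- (u r)\<^sup>2) cosh (w u r)\<close>, cut off at \<open>R\<close>.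
\<close>

definition trunc_cos_integral :: "complex \<Rightarrow> real \<Rightarrow> real \<Rightarrow> complex" where
  "trunc_cos_integral w r R = integral {0..R} (\<lambda>u. cos (of_real u) *
     (exp (- (of_real (u * r))\<^sup>2) * cos (\<i> * w * of_real (u * r))))"

text \<open>
Integration by parts against \<open>cos u\<close>. The profile \<open>\<phi>\<close> enters only through its supremum and its total
variation, and neither changes when the argument is rescaled by \<open>r\<close>; this is why the bound is uniform
in \<open>r\<close> down to \<open>0\<close>, where the estimate by the absolute value grows like \<open>1 / r\<close>.
\<close>

lemma trunc_cos_integral_bounded:
  obtains B where "\<And>r R. r \<ge> 0 \<Longrightarrow> R \<ge> 0 \<Longrightarrow> norm (trunc_cos_integral w r R) \<le> B"
proof -
  define \<phi> where "\<phi> y = exp (- y\<^sup>2) * cos (\<i> * w * y)" for y :: complex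
  define \<phi>' where "\<phi>' y = - (2 * y) * exp (- y\<^sup>2) * cos (\<i> * w * y) - exp (- y\<^sup>2) * sin (\<i> * w * y) * (\<i> * w)" for y :: complex
  \<comment> \<open>Large enough for both bounds below: the exponential is the maximum of
    \<open>exp (- y\<^sup>2 + (norm w + 2) * y)\<close>, where one of the two added units absorbs the linear
    factor of the derivative and the other leaves the decay \<open>exp (- y)\<close>.\<close>
  define D where "D = 2 * (1 + norm w) * exp ((norm w + 2)\<^sup>2 / 4)"
  have exp_bd: "exp (- y\<^sup>2) * exp (norm w * y) \<le> exp ((norm w + 2)\<^sup>2 / 4) * exp (- 2 * y)" for y :: real
  proof -
    have "- y\<^sup>2 + (norm w + 2) * y \<le> (norm w + 2)\<^sup>2 / 4"
      using neg_quadratic_le_max[of 1 y "norm w + 2"] by simp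
    then have "- y\<^sup>2 + norm w * y \<le> (norm w + 2)\<^sup>2 / 4 + (- 2 * y)"
      by (simp only: distrib_right)
    then show ?thesis by (simp only: exp_add[symmetric] exp_le_cancel_iff)
  qed
  have norm_gauss: "norm (exp (- (complex_of_real y)\<^sup>2)) = exp (- y\<^sup>2)" for y
    by (simp flip: of_real_power)
  have \<phi>_bd: "norm (\<phi> (of_real y)) \<le> D" if "y \<ge> 0" for y
  proof -
    have "norm (cos (\<i> * w * of_real y)) \<le> exp (norm w * y)"
      using norm_cos_le[of "\<i> * w * of_real y"] that by (simp add: norm_mult)
    then have "norm (\<phi> (of_real y)) \<le> exp (- y\<^sup>2) * exp (norm w * y)"
      unfolding \<phi>_def norm_mult norm_gauss by (intro mult_left_mono) auto
    also have "\<dots> \<le> exp ((norm w + 2)\<^sup>2 / 4) * exp (- 2 * y)" by (rule exp_bd)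
    also have "\<dots> \<le> exp ((norm w + 2)\<^sup>2 / 4) * (2 * (1 + norm w))"
      using that by (intro mult_left_mono) (auto intro: order_trans[of _ 1])
    finally show ?thesis by (simp add: D_def mult_ac)
  qed
  have \<phi>'_bd: "norm (\<phi>' (of_real y)) \<le> D * exp (- y)" if "y \<ge> 0" for y
  proof -
    have c: "norm (cos (\<i> * w * of_real y)) \<le> exp (norm w * y)"
      using norm_cos_le[of "\<i> * w * of_real y"] that by (simp add: norm_mult)
    have s: "norm (sin (\<i> * w * of_real y)) \<le> exp (norm w * y)"
      using norm_sin_le_exp[of "\<i> * w * of_real y"] that by (simp add: norm_mult)
    have "norm (\<phi>' (of_real y)) \<le> 2 * y * exp (- y\<^sup>2) * norm (cos (\<i> * w * of_real y))
        + exp (- y\<^sup>2) * norm (sin (\<i> * w * of_real y)) * norm w"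
      unfolding \<phi>'_def using that
      by (intro order_trans[OF norm_triangle_ineq4]) (simp add: norm_mult norm_gauss del: norm_exp_eq_Re)
    also have "\<dots> \<le> 2 * y * exp (- y\<^sup>2) * exp (norm w * y) + exp (- y\<^sup>2) * exp (norm w * y) * norm w"
      using that c s by (intro add_mono mult_left_mono mult_right_mono) auto
    also have "\<dots> = (2 * y + norm w) * (exp (- y\<^sup>2) * exp (norm w * y))"
      by (simp add: algebra_simps)
    also have "\<dots> \<le> (2 * (1 + norm w) * exp y) * (exp ((norm w + 2)\<^sup>2 / 4) * exp (- 2 * y))"
    proof (rule mult_mono[OF _ exp_bd])
      have "y \<le> exp y" using exp_ge_add_one_self[of y] by linarith
      moreover have "norm w * 1 \<le> norm w * exp y" using that by (intro mult_left_mono) auto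
      moreover have "0 \<le> norm w * exp y" by simp
      ultimately show "2 * y + norm w \<le> 2 * (1 + norm w) * exp y"
        unfolding distrib_left distrib_right mult_1_right by linarith
    qed (use that in auto)
    also have "\<dots> = D * (exp y * exp (- 2 * y))"
      by (simp only: D_def mult_ac)
    also have "exp y * exp (- 2 * y) = exp (- y)" by (simp flip: exp_add)
    finally show ?thesis .
  qed
  have der: "(\<phi> has_field_derivative \<phi>' y) (at y)" for y
    unfolding \<phi>_def \<phi>'_def by (auto intro!: derivative_eq_intros simp: algebra_simps)
  have "norm (trunc_cos_integral w r R) \<le> 2 * D" if r: "r \<ge> 0" and R: "R \<ge> 0" for r R
  proof -
    define g where "g u = complex_of_real (sin u) * (of_real r * \<phi>' (of_real (u * r)))" for u
    have cont: "continuous_on S (\<lambda>u. \<phi>' (of_real (u * r)))" for S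
      unfolding \<phi>'_def by (intro continuous_intros)
    have "((\<lambda>u. cos (of_real u) * \<phi> (of_real (u * r)) + g u) has_integral
        (of_real (sin R) * \<phi> (of_real (R * r)) - of_real (sin 0) * \<phi> (of_real (0 * r)))) {0..R}"
    proof (rule fundamental_theorem_of_calculus[OF R])
      fix u assume "u \<in> {0..R}"
      have "((\<lambda>u. \<phi> (u * of_real r)) has_field_derivative \<phi>' (of_real u * of_real r) * of_real r) (at (of_real u))"
        by (rule DERIV_chain2[OF der]) (auto intro!: derivative_eq_intros)
      then have "((\<lambda>u. sin u * \<phi> (u * of_real r)) has_field_derivative cos (of_real u) * \<phi> (of_real u * of_real r) + sin (of_real u) * (\<phi>' (of_real u * of_real r) * of_real r)) (at (of_real u))"
        by (auto intro!: derivative_eq_intros)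
      from has_vector_derivative_real_field[OF this]
      show "((\<lambda>u. of_real (sin u) * \<phi> (of_real (u * r))) has_vector_derivative
         cos (of_real u) * \<phi> (of_real (u * r)) + g u) (at u within {0..R})"
        by (simp add: g_def sin_of_real mult_ac has_vector_derivative_at_within)
    qed
    moreover have g_int: "g integrable_on {0..R}"
      unfolding g_def by (intro integrable_continuous_interval continuous_intros cont)
    ultimately have "((\<lambda>u. (cos (of_real u) * \<phi> (of_real (u * r)) + g u) - g u) has_integral
        (of_real (sin R) * \<phi> (of_real (R * r)) - of_real (sin 0) * \<phi> (of_real (0 * r))) - integral {0..R} g) {0..R}"
      by (intro has_integral_diff) (auto intro: integrable_integral)
    then have eq: "trunc_cos_integral w r R = of_real (sin R) * \<phi> (of_real (R * r)) - integral {0..R} g"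
      unfolding trunc_cos_integral_def by (simp add: \<phi>_def integral_unique mult_ac)
    have "((\<lambda>u. D * r * exp (- (u * r))) has_integral (- D * exp (- (R * r)) - (- D * exp (- (0 * r))))) {0..R}"
      by (rule fundamental_theorem_of_calculus[OF R])
         (auto intro!: derivative_eq_intros simp flip: has_real_derivative_iff_has_vector_derivative)
    then have "norm (integral {0..R} g) \<le> - D * exp (- (R * r)) - (- D * exp (- (0 * r)))"
    proof (intro integral_norm_bound_integral[OF g_int, THEN order_trans])
      fix u assume u: "u \<in> {0..R}"
      have "norm (g u) \<le> 1 * (r * (D * exp (- (u * r))))"
        unfolding g_def norm_mult using \<phi>'_bd[of "u * r"] u r by (intro mult_mono) (auto simp: norm_mult)
      then show "norm (g u) \<le> D * r * exp (- (u * r))" by (simp add: mult_ac)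
    qed (auto simp: has_integral_integrable_integral)
    also have "\<dots> \<le> D" by (simp add: D_def)
    finally have "norm (integral {0..R} g) \<le> D" .
    moreover have "norm (of_real (sin R) * \<phi> (of_real (R * r))) \<le> 1 * D"
      unfolding norm_mult using \<phi>_bd[of "R * r"] r R by (intro mult_mono) auto
    ultimately show ?thesis unfolding eq using norm_triangle_ineq4 by (smt (verit))
  qed
  then show ?thesis using that by blast
qed

text \<open>
The Gaussian integral returned to a half-line variable \<open>u = exp v\<close>, because the improper integral cuts
\<open>u\<close> off at \<open>R\<close>.
\<close>

lemma half_line_gaussian_cos:
  assumes A: "Re A > 0"
  shows "(\<lambda>u. exp (- (A * of_real (u\<^sup>2))) * cos (k * of_real u)) absolutely_integrable_on {0..}"
    and "integral {0..} (\<lambda>u. exp (- (A * of_real (u\<^sup>2))) * cos (k * of_real u))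
       = of_real (sqrt pi) / (2 * csqrt A) * exp (- (k\<^sup>2 / (4 * A)))"
proof -
  define f where "f u = exp (- (A * of_real (u\<^sup>2))) * cos (k * of_real u)" for u :: real
  define J where "J = of_real (sqrt pi) / (2 * csqrt A) * exp (- (k\<^sup>2 / (4 * A)))"
  have eq: "\<bar>exp v\<bar> *\<^sub>R f (exp v) = gauss_cos A k 1 v" for v
  proof -
    have "complex_of_real (exp (2 * v)) = of_real ((exp v)\<^sup>2)" by (simp add: exp_double)
    then show ?thesis
      unfolding f_def gauss_cos_def by (simp add: scaleR_conv_of_real exp_of_real mult_ac)
  qed
  have b: "has_bochner_integral lborel (gauss_cos A k 1) J"
    unfolding J_def by (rule has_bochner_integral_gaussian_cos[OF A])
  have "gauss_cos A k 1 absolutely_integrable_on UNIV"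
    using b by (simp add: set_integrable_def integrable_completion has_bochner_integral_iff)
  moreover have "integral UNIV (gauss_cos A k 1) = J"
    using has_integral_integral_lborel[of "gauss_cos A k 1"] b
    by (simp add: has_bochner_integral_iff integral_unique)
  ultimately have "(\<lambda>v. \<bar>exp v\<bar> *\<^sub>R f (exp v)) absolutely_integrable_on UNIV \<and> integral UNIV (\<lambda>v. \<bar>exp v\<bar> *\<^sub>R f (exp v)) = J"
    unfolding eq by simp
  then have pos: "f absolutely_integrable_on range exp \<and> integral (range exp) f = J"
    by (subst (asm) has_absolute_integral_change_of_variables_real) (auto simp: inj_on_def intro: DERIV_subset DERIV_exp)
  have "{0..} - range (exp :: real \<Rightarrow> real) \<subseteq> {0}"
  proof
    fix y :: real assume y: "y \<in> {0..} - range exp"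
    then have "\<not> y > 0" by (metis DiffD2 exp_ln rangeI)
    with y show "y \<in> {0}" by auto
  qed
  then have n1: "negligible {y \<in> {0..} - range exp. f y \<noteq> 0}"
    by (intro negligible_subset[OF negligible_sing[of 0]]) blast
  have "{y \<in> range exp - {0..}. f y \<noteq> 0} = {}"
    using less_imp_le[OF exp_gt_zero] by (blast intro: atLeast_iff[THEN iffD2])
  then have n2: "negligible {y \<in> range exp - {0..}. f y \<noteq> 0}" by (simp only: negligible_empty)
  have "f absolutely_integrable_on {0..}"
    by (rule absolutely_integrable_spike_set_eq[OF n2 n1, THEN iffD1]) (rule pos[THEN conjunct1])
  moreover have "integral {0..} f = J"
    by (rule trans[OF integral_spike_set[OF n2 n1, symmetric] pos[THEN conjunct2]])
  ultimately show "(\<lambda>u. exp (- (A * of_real (u\<^sup>2))) * cos (k * of_real u)) absolutely_integrable_on {0..}"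
    "integral {0..} (\<lambda>u. exp (- (A * of_real (u\<^sup>2))) * cos (k * of_real u)) = of_real (sqrt pi) / (2 * csqrt A) * exp (- (k\<^sup>2 / (4 * A)))"
    unfolding f_def J_def by simp_all
qed

lemma tendsto_half_line_gaussian_cos:
  assumes A: "Re A > 0"
  shows "((\<lambda>R. integral {0..R} (\<lambda>u. exp (- (A * of_real (u\<^sup>2))) * cos (k * of_real u)))
     \<longlongrightarrow> of_real (sqrt pi) / (2 * csqrt A) * exp (- (k\<^sup>2 / (4 * A)))) at_top"
proof -
  define f where "f u = exp (- (A * of_real (u\<^sup>2))) * cos (k * of_real u)" for u :: real
  have int: "set_integrable lebesgue {0..} f"
    using half_line_gaussian_cos(1)[OF A] unfolding f_def .
  have "((\<lambda>R. set_lebesgue_integral lebesgue {0..R} f) \<longlongrightarrow> set_lebesgue_integral lebesgue {0..} f) at_top"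
    by (rule tendsto_set_lebesgue_integral_at_top[OF _ int]) simp
  moreover have "set_lebesgue_integral lebesgue {0..R} f = integral {0..R} f" for R
    by (rule set_lebesgue_integral_eq_integral(2)) (rule set_integrable_subset[OF int], auto)
  moreover have "set_lebesgue_integral lebesgue {0..} f = integral {0..} f"
    by (rule set_lebesgue_integral_eq_integral(2)[OF int])
  ultimately show ?thesis
    using half_line_gaussian_cos(2)[OF A, of k] unfolding f_def by simp
qed

text \<open>
The frequencies are now \<open>1 + \<i> w r\<close> and \<open>1 - \<i> w r\<close>, and the scale is \<open>r\<^sup>2\<close>. For fixed \<open>r\<close> the integral
over the half-line converges absolutely.
\<close>

lemma trunc_cos_integral_tendsto:
  assumes r: "r > 0"
  shows "((\<lambda>R. trunc_cos_integral w r R) \<longlongrightarrow>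
     of_real (sqrt pi) / (2 * of_real r) * exp (w\<^sup>2 / 4) * (exp (- (1 / (4 * (of_real r)\<^sup>2))) * cos (w / (2 * of_real r)))) at_top"
proof -
  define A where "A = complex_of_real (r\<^sup>2)"
  define k1 where "k1 = 1 + \<i> * w * of_real r"
  define k2 where "k2 = 1 - \<i> * w * of_real r"
  define f where "f k u = exp (- (A * of_real (u\<^sup>2))) * cos (k * of_real u)" for k and u :: real
  have A: "Re A > 0" using r by (simp add: A_def)
  have r0: "complex_of_real r \<noteq> 0" using r by simp
  have fint: "f k integrable_on {0..R}" for k R
    unfolding f_def by (intro integrable_continuous_interval continuous_intros)
  have split: "trunc_cos_integral w r R = (integral {0..R} (f k1) + integral {0..R} (f k2)) / 2" for R
  proof -
    have "cos (of_real u) * (exp (- (of_real (u * r))\<^sup>2) * cos (\<i> * w * of_real (u * r))) = (f k1 u + f k2 u) / 2" for u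
    proof -
      have k: "k1 * of_real u = of_real u + \<i> * w * of_real (u * r)" "k2 * of_real u = of_real u - \<i> * w * of_real (u * r)"
        by (simp_all add: k1_def k2_def algebra_simps)
      show ?thesis unfolding f_def k cos_add cos_diff
        by (simp add: A_def power_mult_distrib algebra_simps)
    qed
    then have "trunc_cos_integral w r R = integral {0..R} (\<lambda>u. (f k1 u + f k2 u) / 2)"
      unfolding trunc_cos_integral_def by (simp only:)
    also have "\<dots> = (integral {0..R} (f k1) + integral {0..R} (f k2)) / 2"
      using integral_add[OF fint fint] by simp
    finally show ?thesis .
  qed
  have lim: "((\<lambda>R. (integral {0..R} (f k1) + integral {0..R} (f k2)) / 2) \<longlongrightarrow>
     (of_real (sqrt pi) / (2 * csqrt A) * exp (- (k1\<^sup>2 / (4 * A))) + of_real (sqrt pi) / (2 * csqrt A) * exp (- (k2\<^sup>2 / (4 * A)))) / 2) at_top"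
    unfolding f_def by (intro tendsto_divide tendsto_add tendsto_half_line_gaussian_cos A tendsto_const) simp
  have val: "(of_real (sqrt pi) / (2 * csqrt A) * exp (- (k1\<^sup>2 / (4 * A))) + of_real (sqrt pi) / (2 * csqrt A) * exp (- (k2\<^sup>2 / (4 * A)))) / 2
     = of_real (sqrt pi) / (2 * of_real r) * exp (w\<^sup>2 / 4) * (exp (- (1 / (4 * (of_real r)\<^sup>2))) * cos (w / (2 * of_real r)))"
  proof -
    have c: "csqrt A = of_real r" using r unfolding A_def by (simp add: csqrt_of_real_nonneg)
    have "- (k1\<^sup>2 / (4 * A)) = w\<^sup>2 / 4 + (- (1 / (4 * (of_real r)\<^sup>2))) + (- (\<i> * (w / (2 * of_real r))))"
      using r0 by (simp add: k1_def A_def field_simps power2_eq_square)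
    then have e1: "exp (- (k1\<^sup>2 / (4 * A))) = exp (w\<^sup>2 / 4) * exp (- (1 / (4 * (of_real r)\<^sup>2))) * exp (- (\<i> * (w / (2 * of_real r))))"
      by (simp only: exp_add)
    have "- (k2\<^sup>2 / (4 * A)) = w\<^sup>2 / 4 + (- (1 / (4 * (of_real r)\<^sup>2))) + (\<i> * (w / (2 * of_real r)))"
      using r0 by (simp add: k2_def A_def field_simps power2_eq_square)
    then have e2: "exp (- (k2\<^sup>2 / (4 * A))) = exp (w\<^sup>2 / 4) * exp (- (1 / (4 * (of_real r)\<^sup>2))) * exp (\<i> * (w / (2 * of_real r)))"
      by (simp only: exp_add)
    show ?thesis unfolding c e1 e2 cos_exp_eq using r0 by (simp add: field_simps)
  qed
  show ?thesis unfolding split using lim unfolding val .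
qed

section \<open>Passage to the improper integral\<close>

definition bessel_kernel :: "complex \<Rightarrow> complex \<Rightarrow> real \<Rightarrow> complex" where
  "bessel_kernel w x u = exp (- (w\<^sup>2 * x\<^sup>2 / (2 * (x\<^sup>2 + (of_real u)\<^sup>2))))
        * cos (w\<^sup>2 * x * of_real u / (2 * (x\<^sup>2 + (of_real u)\<^sup>2))) / csqrt (x\<^sup>2 + (of_real u)\<^sup>2)"

text \<open>
For finite \<open>R\<close>, insert the Gaussian representation of the kernel and exchange the integrals. On
\<open>{0..R}\<close> the growth \<open>exp (norm w * u * exp v)\<close> of the hyperbolic cosine is at most
\<open>exp (norm w * R * exp v)\<close>, so there is a majorant integrable over the product.
\<close>

lemma truncated_integral_eq:
  assumes x: "Re (x\<^sup>2) > 0"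
  shows "integrable lborel (\<lambda>v. gauss_cos (x\<^sup>2) (w * x) 1 v * trunc_cos_integral w (exp v) R)"
    and "integral {0..R} (\<lambda>u. cos (of_real u) * bessel_kernel w x u)
      = 2 / of_real (sqrt pi) * exp (- (w\<^sup>2 / 4)) *
        (\<integral>v. gauss_cos (x\<^sup>2) (w * x) 1 v * trunc_cos_integral w (exp v) R \<partial>lborel)"
proof -
  define g where "g = gauss_cos (x\<^sup>2) (w * x) 1"
  define h where "h u v = exp (- (of_real (u * exp v))\<^sup>2) * cos (\<i> * w * of_real (u * exp v))" for u v :: real
  define I where "I u = complex_of_real (indicator {0..R} u)" for u
  define P where "P u v = I u * (cos (of_real u) * (g v * h u v))" for u v
  define b where "b v = exp (- (Re (x\<^sup>2) * exp (2 * v)) + (norm (w * x) + norm w * R) * exp v + 1 * v)" for v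
  have [measurable]: "g \<in> borel_measurable borel" unfolding g_def by measurable
  have [measurable]: "I \<in> borel_measurable borel" unfolding I_def by measurable
  have Pm: "case_prod P \<in> borel_measurable (lborel \<Otimes>\<^sub>M lborel)"
    unfolding P_def h_def by measurable
  have bnd: "norm (P u v) \<le> norm (I u * of_real (b v))" for u v
  proof (cases "u \<in> {0..R}")
    case True
    have "norm (cos (complex_of_real u)) \<le> 1" by (simp add: cos_of_real)
    moreover have "norm (g v) \<le> exp (- (Re (x\<^sup>2) * exp (2 * v)) + norm (w * x) * exp v + 1 * v)"
      unfolding g_def using norm_gauss_cos_le[of "w * x" "norm (w * x)" "x\<^sup>2" 1 v] by simp
    moreover have "norm (h u v) \<le> exp (norm w * R * exp v)"
    proof -
      have "norm (cos (\<i> * w * of_real (u * exp v))) \<le> exp (norm w * (u * exp v))"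
        using norm_cos_le[of "\<i> * w * of_real (u * exp v)"] True by (simp add: norm_mult)
      also have "\<dots> \<le> exp (norm w * (R * exp v))"
        using True by (simp add: mult_left_mono mult_right_mono)
      finally have "norm (cos (\<i> * w * of_real (u * exp v))) \<le> exp (norm w * R * exp v)" by (simp add: mult.assoc)
      moreover have "norm (exp (- (complex_of_real (u * exp v))\<^sup>2)) \<le> 1" by (simp flip: of_real_power)
      ultimately have "norm (h u v) \<le> 1 * exp (norm w * R * exp v)"
        unfolding h_def norm_mult by (intro mult_mono) auto
      then show ?thesis by simp
    qed
    ultimately have "norm (cos (complex_of_real u) * (g v * h u v)) \<le> 1 * (exp (- (Re (x\<^sup>2) * exp (2 * v)) + norm (w * x) * exp v + 1 * v) * exp (norm w * R * exp v))"
      unfolding norm_mult[of "cos _"] norm_mult[of "g v"] by (intro mult_mono) auto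
    also have "\<dots> = b v" unfolding b_def by (simp add: algebra_simps flip: exp_add)
    finally show ?thesis using True by (simp add: P_def I_def b_def)
  qed (simp add: P_def I_def)
  have "integrable lborel I"
    unfolding I_def
    by (intro integrable_of_real integrable_real_indicator) (auto simp: emeasure_lborel_Icc_eq)
  moreover have "integrable lborel (\<lambda>v. complex_of_real (b v))"
    unfolding b_def by (intro integrable_of_real integrable_gauss_bound x) simp
  ultimately have Pint: "integrable (lborel \<Otimes>\<^sub>M lborel) (case_prod P)"
    by (rule Bochner_Integration.integrable_bound[OF integrable_lborel_prod _ _, OF _ _ Pm])
       (use bnd in auto)
  define C where "C = of_real (sqrt pi) / 2 * exp (w\<^sup>2 / 4)"
  have Pu: "(\<integral>v. P u v \<partial>lborel) = C * (indicator {0..R} u *\<^sub>R (cos (of_real u) * bessel_kernel w x u))" for u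
  proof -
    have "(\<integral>v. g v * h u v \<partial>lborel) = C * bessel_kernel w x u"
      using has_bochner_integral_kernel[OF x, of w u]
      unfolding g_def h_def C_def bessel_kernel_def by (simp add: has_bochner_integral_iff)
    then show ?thesis unfolding P_def I_def by (simp add: scaleR_conv_of_real)
  qed
  have Pv: "(\<integral>u. P u v \<partial>lborel) = g v * trunc_cos_integral w (exp v) R" for v
  proof -
    have "set_integrable lborel {0..R} (\<lambda>u. cos (of_real u) * h u v)"
      unfolding h_def by (intro borel_integrable_atLeastAtMost' continuous_intros)
    from set_borel_integral_eq_integral(2)[OF this]
    have "(\<integral>u. I u * (cos (of_real u) * h u v) \<partial>lborel) = trunc_cos_integral w (exp v) R"
      by (simp add: trunc_cos_integral_def h_def I_def set_lebesgue_integral_def scaleR_conv_of_real)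
    moreover have "(\<integral>u. P u v \<partial>lborel) = (\<integral>u. g v * (I u * (cos (of_real u) * h u v)) \<partial>lborel)"
      unfolding P_def by (simp add: mult_ac)
    ultimately show ?thesis by simp
  qed
  show int: "integrable lborel (\<lambda>v. gauss_cos (x\<^sup>2) (w * x) 1 v * trunc_cos_integral w (exp v) R)"
    using lborel_pair.integrable_snd[OF Pint] unfolding Pv g_def .
  have C0: "C \<noteq> 0" by (simp add: C_def)
  have "integrable lborel (\<lambda>u. C * (indicator {0..R} u *\<^sub>R (cos (of_real u) * bessel_kernel w x u)))"
    using lborel_pair.integrable_fst[OF Pint] unfolding Pu .
  from integrable_mult_right[OF this, of "1 / C"] C0
  have "set_integrable lborel {0..R} (\<lambda>u. cos (of_real u) * bessel_kernel w x u)"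
    by (simp add: set_integrable_def)
  from set_borel_integral_eq_integral(2)[OF this]
  have "C * integral {0..R} (\<lambda>u. cos (of_real u) * bessel_kernel w x u) = (\<integral>u. (\<integral>v. P u v \<partial>lborel) \<partial>lborel)"
    by (simp only: Pu set_lebesgue_integral_def integral_mult_right_zero)
  also have "\<dots> = (\<integral>v. (\<integral>u. P u v \<partial>lborel) \<partial>lborel)"
    by (rule lborel_pair.Fubini_integral[OF Pint, symmetric])
  finally have CI: "C * integral {0..R} (\<lambda>u. cos (of_real u) * bessel_kernel w x u)
      = (\<integral>v. g v * trunc_cos_integral w (exp v) R \<partial>lborel)"
    unfolding Pv .
  have "2 / of_real (sqrt pi) * exp (- (w\<^sup>2 / 4)) * C = 1"
    by (simp add: C_def exp_minus)
  then have "integral {0..R} (\<lambda>u. cos (of_real u) * bessel_kernel w x u)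
      = 2 / of_real (sqrt pi) * exp (- (w\<^sup>2 / 4)) * C
         * integral {0..R} (\<lambda>u. cos (of_real u) * bessel_kernel w x u)"
    by (simp only: mult_1)
  also have "\<dots> = 2 / of_real (sqrt pi) * exp (- (w\<^sup>2 / 4))
         * (\<integral>v. g v * trunc_cos_integral w (exp v) R \<partial>lborel)"
    by (simp only: mult.assoc CI)
  finally show "integral {0..R} (\<lambda>u. cos (of_real u) * bessel_kernel w x u)
      = 2 / of_real (sqrt pi) * exp (- (w\<^sup>2 / 4)) *
        (\<integral>v. gauss_cos (x\<^sup>2) (w * x) 1 v * trunc_cos_integral w (exp v) R \<partial>lborel)"
    unfolding g_def .
qed

text \<open>
Dominated convergence in \<open>v\<close>. The uniform bound on the truncated cosine integrals replaces the
absolute integrability that the integral over \<open>u\<close> lacks.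
\<close>

lemma improper_integral_tendsto:
  assumes x: "Re (x\<^sup>2) > 0"
  shows "((\<lambda>R. integral {0..R} (\<lambda>u. cos (of_real u) * bessel_kernel w x u)) \<longlongrightarrow>
     (\<integral>v. gauss_cos (x\<^sup>2) (w * x) 0 v * gauss_cos (1 / 4) (w / 2) 0 (- v) \<partial>lborel)) at_top"
proof -
  define g where "g = gauss_cos (x\<^sup>2) (w * x) 1"
  \<comment> \<open>The limit of the truncated cosine integral at \<open>r = exp v\<close>.\<close>
  define H where "H v = of_real (sqrt pi) / (2 * of_real (exp v)) * exp (w\<^sup>2 / 4)
     * (exp (- (1 / (4 * (of_real (exp v))\<^sup>2))) * cos (w / (2 * of_real (exp v))))" for v
  define C where "C = 2 / of_real (sqrt pi) * exp (- (w\<^sup>2 / 4))"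
  obtain B where B: "\<And>r R. r \<ge> 0 \<Longrightarrow> R \<ge> 0 \<Longrightarrow> norm (trunc_cos_integral w r R) \<le> B"
    using trunc_cos_integral_bounded by blast
  have "((\<lambda>R. \<integral>v. g v * trunc_cos_integral w (exp v) R \<partial>lborel) \<longlongrightarrow> (\<integral>v. g v * H v \<partial>lborel)) at_top"
  proof (rule integral_dominated_convergence_at_top)
    show "integrable lborel (\<lambda>v. exp (- (Re (x\<^sup>2) * exp (2 * v)) + norm (w * x) * exp v + 1 * v) * B)"
      by (intro integrable_mult_left integrable_gauss_bound x) simp
    show "(\<lambda>v. g v * trunc_cos_integral w (exp v) R) \<in> borel_measurable lborel" for R
      using truncated_integral_eq(1)[OF x, of w R] unfolding g_def by (rule borel_measurable_integrable)
    have "continuous_on UNIV (\<lambda>v. g v * H v)"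
      unfolding g_def H_def by (intro continuous_intros continuous_on_gauss_cos) auto
    then show "(\<lambda>v. g v * H v) \<in> borel_measurable lborel"
      by (simp add: borel_measurable_continuous_onI)
    show "AE v in lborel. ((\<lambda>R. g v * trunc_cos_integral w (exp v) R) \<longlongrightarrow> g v * H v) at_top"
      unfolding H_def by (intro AE_I2 tendsto_mult tendsto_const trunc_cos_integral_tendsto) simp
    show "\<forall>\<^sub>F R in at_top. AE v in lborel. norm (g v * trunc_cos_integral w (exp v) R)
        \<le> exp (- (Re (x\<^sup>2) * exp (2 * v)) + norm (w * x) * exp v + 1 * v) * B"
      using eventually_ge_at_top[of 0]
    proof eventually_elim
      case (elim R)
      have "norm (g v) \<le> exp (- (Re (x\<^sup>2) * exp (2 * v)) + norm (w * x) * exp v + 1 * v)" for v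
        unfolding g_def using norm_gauss_cos_le[of "w * x" "norm (w * x)" "x\<^sup>2" 1 v] by simp
      then show ?case
        using elim unfolding norm_mult[of "g _"] by (intro AE_I2 mult_mono B) auto
    qed
  qed
  then have "((\<lambda>R. C * (\<integral>v. g v * trunc_cos_integral w (exp v) R \<partial>lborel)) \<longlongrightarrow> C * (\<integral>v. g v * H v \<partial>lborel)) at_top"
    by (intro tendsto_mult tendsto_const)
  moreover have "C * (\<integral>v. g v * H v \<partial>lborel) = (\<integral>v. C * (g v * H v) \<partial>lborel)" by simp
  moreover have "C * (g v * H v) = gauss_cos (x\<^sup>2) (w * x) 0 v * gauss_cos (1 / 4) (w / 2) 0 (- v)" for v
  proof -
    have CH: "C * H v * of_real (exp v) = exp (- (1 / (4 * (of_real (exp v))\<^sup>2))) * cos (w / (2 * of_real (exp v)))"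
      unfolding C_def H_def by (simp add: exp_minus field_simps)
    have g: "g v = gauss_cos (x\<^sup>2) (w * x) 0 v * of_real (exp v)"
      by (simp add: g_def gauss_cos_def exp_of_real)
    have "gauss_cos (1 / 4) (w / 2) 0 (- v) = exp (- (1 / (4 * (of_real (exp v))\<^sup>2))) * cos (w / (2 * of_real (exp v)))"
    proof -
      have e: "complex_of_real (exp (2 * (- v))) = 1 / (of_real (exp v))\<^sup>2" "complex_of_real (exp (- v)) = 1 / of_real (exp v)"
        by (simp_all add: exp_minus exp_double power_inverse divide_inverse)
      show ?thesis unfolding gauss_cos_def e by simp
    qed
    then show ?thesis unfolding g CH[symmetric] by (simp add: mult_ac)
  qed
  ultimately show ?thesis
    unfolding truncated_integral_eq(2)[OF x] C_def[symmetric] g_def[symmetric] by simp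
qed

theorem theorem1p8:
  fixes w x :: complex and c :: real
  assumes "x \<noteq> 0" and "\<bar>Arg x\<bar> < pi / 4" and "c > 0"
  shows "integrable lborel (\<lambda>t. gen_bessel_integrand 0 w x (Complex c t)) \<and>
    ((\<lambda>R. integral {0..R} (\<lambda>u::real.
        exp (- (w\<^sup>2 * x\<^sup>2 / (2 * (x\<^sup>2 + (of_real u)\<^sup>2))))
        * cos (w\<^sup>2 * x * of_real u / (2 * (x\<^sup>2 + (of_real u)\<^sup>2)))
        * (cos (of_real u) / csqrt (x\<^sup>2 + (of_real u)\<^sup>2))))
      \<longlongrightarrow> gen_bessel_K c 0 w x) at_top"
proof -
  have "x\<^sup>2 = exp (2 * Ln x)" using assms by (simp add: exp_double)
  then have x: "Re (x\<^sup>2) > 0"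
    using assms Re_exp_double_pos[of "Ln x"] by (simp add: Arg_eq_Im_Ln)
  have "exp (- (w\<^sup>2 * x\<^sup>2 / (2 * (x\<^sup>2 + (of_real u)\<^sup>2))))
        * cos (w\<^sup>2 * x * of_real u / (2 * (x\<^sup>2 + (of_real u)\<^sup>2)))
        * (cos (of_real u) / csqrt (x\<^sup>2 + (of_real u)\<^sup>2))
      = cos (of_real u) * bessel_kernel w x u" for u
    by (simp add: bessel_kernel_def)
  then show ?thesis
    using gen_bessel_K_eq[OF assms] improper_integral_tendsto[OF x, of w] by simp
qed

end
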